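(* Let $p$ be a symmetric nc polynomial of degree $d$ in $g$ symmetric variables, and let $\widetilde\nu=1+g+\cdots+g^{d-1}$. Suppose $n>\frac12 g\widetilde\nu(\widetilde\nu-1)$, $X\in(\mathbb{R}^{n\times n}_{sym})^g$, $v\in\mathbb{R}^n$, and there is no nonzero nc polynomial $q$ (not necessarily symmetric) of degree less than $d$ such that $q(X)v=0$. If the relaxed Hessian of $p$ is positive at $(X,v)$, then $p$ is convex and has degree at most two.
   Context: An nc polynomial is an element of the free algebra $\mathbb{R}\langle x\rangle$ in noncommuting variables $x_1,\dots,x_g$ with real coefficients. The involution $T$ is the linear map with $x_j^T=x_j$ (and $h_j^T=h_j$) that reverses words; $p$ is symmetric if $p^T=p$. $(\mathbb{R}^{n\times n}_{sym})^g$ is the set of $g$-tuples of real symmetric $n\times n$ matrices, at which nc polynomials are evaluated by substitution. $p'(x)[h]=\frac{d}{dt}p(x+th)|_{t=0}$ and $p''(x)[h]=\frac{d^2}{dt^2}p(x+th)|_{t=0}$ are nc polynomials in the $2g$ variables $x_1,\dots,x_g,h_1,\dots,h_g$. For $p$ of degree $d$ and $\lambda,\delta\in\mathbb{R}$, the relaxed Hessian is $$p''_{\lambda,\delta}(x)[h]=p''(x)[h]+\delta\sum_{j=1}^g\sum_{|m|\le d-1}m(x)^Th_j^2m(x)+\lambda\,p'(x)[h]^Tp'(x)[h],$$ where $m$ runs over all words in $x$ of length at most $d-1$. The relaxed Hessian is positive at $(X,v)\in(\mathbb{R}^{n\times n}_{sym})^g\times\mathbb{R}^n$ if for each $\delta>0$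 there is a $\lambda>0$ such that $\langle p''_{\lambda,\delta}(X)[H]v,v\rangle\ge 0$ for all $H\in(\mathbb{R}^{n\times n}_{sym})^g$. A symmetric nc polynomial $p$ is (matrix) convex if $p(tX+(1-t)Y)\preceq tp(X)+(1-t)p(Y)$ for every $n$, all $X,Y\in(\mathbb{R}^{n\times n}_{sym})^g$ and $0\le t\le 1$. *)

theory Defs
  imports
    "HOL-Analysis.Derivative"
    "HOL-Library.Poly_Mapping"
    "Jordan_Normal_Form.Matrix"
begin

no_notation inner (infix \<open>\<bullet>\<close> 70)

text \<open>Words are lists; under concatenation they form the free monoid, written additively so that the
  convolution product of \<^theory>\<open>HOL-Library.Poly_Mapping\<close> is the product of the monoid algebra.\<close>

instantiation list :: (type) monoid_add
begin
definition zero_list :: "'a list" where "zero_list = []"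
definition plus_list :: "'a list \<Rightarrow> 'a list \<Rightarrow> 'a list" where "plus_list = (@)"
instance by standard (simp_all add: zero_list_def plus_list_def)
end

type_synonym 'v ncpoly = "('v list, real) poly_mapping"

definition nc_const :: "real \<Rightarrow> 'v ncpoly" where
  "nc_const c = Poly_Mapping.single [] c"

definition nc_word :: "'v list \<Rightarrow> 'v ncpoly" where
  "nc_word w = Poly_Mapping.single w 1"

definition nc_var :: "'v \<Rightarrow> 'v ncpoly" where
  "nc_var j = nc_word [j]"

text \<open>The zero polynomial gets degree 0.\<close>
definition nc_degree :: "'v ncpoly \<Rightarrow> nat" where
  "nc_degree p = Max (insert 0 (length ` Poly_Mapping.keys p))"

definition nc_adj :: "'v ncpoly \<Rightarrow> 'v ncpoly" where
  "nc_adj p = Poly_Mapping.map_key rev p"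

definition nc_symmetric :: "'v ncpoly \<Rightarrow> bool" where
  "nc_symmetric p \<longleftrightarrow> nc_adj p = p"

lemma lookup_nc_adj: "Poly_Mapping.lookup (nc_adj p) w = Poly_Mapping.lookup p (rev w)"
  by (simp add: nc_adj_def map_key.rep_eq)

definition nc_subst :: "('v \<Rightarrow> 'u ncpoly) \<Rightarrow> 'v ncpoly \<Rightarrow> 'u ncpoly" where
  "nc_subst Y p =
     (\<Sum>w\<in>Poly_Mapping.keys p. nc_const (Poly_Mapping.lookup p w) * prod_list (map Y w))"

text \<open>Polynomials in the \<open>2g\<close> variables \<open>x, h\<close> have variables of type \<open>'g + 'g\<close>, with \<open>x\<^sub>j = Inl j\<close>
  and \<open>h\<^sub>j = Inr j\<close>. The next function is \<open>p(x + t h)\<close>.\<close>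
definition nc_shift :: "'g ncpoly \<Rightarrow> real \<Rightarrow> ('g + 'g) ncpoly" where
  "nc_shift p t = nc_subst (\<lambda>j. nc_var (Inl j) + nc_const t * nc_var (Inr j)) p"

lemma length_keys_nc_shift:
  assumes "u \<in> Poly_Mapping.keys (nc_shift p t)"
  shows "length u \<le> nc_degree p"
proof -
  define Y :: "'a \<Rightarrow> ('a + 'a) ncpoly"
    where "Y = (\<lambda>j. nc_var (Inl j) + nc_const t * nc_var (Inr j))"
  have kY: "length u = 1" if "u \<in> Poly_Mapping.keys (Y j)" for u j
  proof -
    have "Y j = Poly_Mapping.single [Inl j] 1 + Poly_Mapping.single [Inr j] t"
      by (simp add: Y_def nc_var_def nc_word_def nc_const_def mult_single plus_list_def)
    then show ?thesis
      using that Poly_Mapping.keys_add[of "Poly_Mapping.single [Inl j] 1" "Poly_Mapping.single [Inr j] t"]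
      by (auto split: if_splits)
  qed
  have kw: "length u = length w" if "u \<in> Poly_Mapping.keys (prod_list (map Y w))" for u w
    using that
  proof (induction w arbitrary: u)
    case Nil
    then show ?case by (simp add: zero_list_def)
  next
    case (Cons j w)
    then obtain a b where "u = a + b" "a \<in> Poly_Mapping.keys (Y j)"
      "b \<in> Poly_Mapping.keys (prod_list (map Y w))"
      using keys_mult[of "Y j" "prod_list (map Y w)"] by auto
    then show ?case using kY[of a j] Cons.IH[of b] by (simp add: plus_list_def)
  qed
  from assms obtain w where w: "w \<in> Poly_Mapping.keys p"
    and u: "u \<in> Poly_Mapping.keys (nc_const (Poly_Mapping.lookup p w) * prod_list (map Y w))"
    using keys_sum[of "\<lambda>w. nc_const (Poly_Mapping.lookup p w) * prod_list (map Y w)"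
        "Poly_Mapping.keys p"]
    unfolding nc_shift_def nc_subst_def Y_def[symmetric] by blast
  from u obtain b where "u = [] + b" "b \<in> Poly_Mapping.keys (prod_list (map Y w))"
    using keys_mult[of "nc_const (Poly_Mapping.lookup p w)" "prod_list (map Y w)"]
    by (auto simp: nc_const_def split: if_splits)
  then have "length u = length w" using kw by (simp add: plus_list_def)
  also have "\<dots> \<le> nc_degree p" unfolding nc_degree_def using w by (intro Max_ge) auto
  finally show ?thesis .
qed

text \<open>The \<open>k\<close>-th derivative of \<open>t \<mapsto> p(x + t h)\<close> at \<open>t = 0\<close>, taken coefficientwise. Each coefficient
  is a polynomial function of \<open>t\<close>, and the words occurring have length at most \<open>deg p\<close>
  for every \<open>t\<close>.\<close>
lift_definition nc_dderiv :: "nat \<Rightarrow> 'g::finite ncpoly \<Rightarrow> ('g + 'g) ncpoly" is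
  "\<lambda>k (p :: 'g ncpoly) w. (deriv ^^ k) (\<lambda>t. Poly_Mapping.lookup (nc_shift p t) w) 0"
proof -
  fix k and p :: "'g ncpoly"
  have deriv0: "(deriv ^^ k) (\<lambda>t::real. 0::real) = (\<lambda>t. 0)"
    by (induction k) simp_all
  have "Poly_Mapping.lookup (nc_shift p t) w = 0" if "\<not> length w \<le> nc_degree p" for w t
    using length_keys_nc_shift[of w p t] that by (meson in_keys_iff)
  then have "(deriv ^^ k) (\<lambda>t. Poly_Mapping.lookup (nc_shift p t) w) 0 = 0"
    if "\<not> length w \<le> nc_degree p" for w
    using that deriv0 by simp
  then have "{w. (deriv ^^ k) (\<lambda>t. Poly_Mapping.lookup (nc_shift p t) w) 0 \<noteq> 0}
      \<subseteq> {w. set w \<subseteq> UNIV \<and> length w \<le> nc_degree p}"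
    by blast
  then show "finite {w. (deriv ^^ k) (\<lambda>t. Poly_Mapping.lookup (nc_shift p t) w) 0 \<noteq> 0}"
    by (rule finite_subset) (rule finite_lists_length_le, simp)
qed

text \<open>The condition \<open>|m| \<le> d - 1\<close> is written \<open>|m| < d\<close>, so that no word qualifies when \<open>d = 0\<close>.\<close>
definition relaxed_hessian :: "'g::finite ncpoly \<Rightarrow> real \<Rightarrow> real \<Rightarrow> ('g + 'g) ncpoly" where
  "relaxed_hessian p l \<delta> =
     nc_dderiv 2 p
     + nc_const \<delta> *
         (\<Sum>j\<in>UNIV. \<Sum>m\<in>{m :: 'g list. length m < nc_degree p}.
            nc_adj (nc_word (map Inl m)) * nc_var (Inr j) ^ 2 * nc_word (map Inl m))
     + nc_const l * (nc_adj (nc_dderiv 1 p) * nc_dderiv 1 p)"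

definition sym_mats :: "nat \<Rightarrow> real mat set" where
  "sym_mats n = {A \<in> carrier_mat n n. transpose_mat A = A}"

definition word_eval :: "nat \<Rightarrow> ('v \<Rightarrow> real mat) \<Rightarrow> 'v list \<Rightarrow> real mat" where
  "word_eval n X w = foldr (\<lambda>j A. X j * A) w (1\<^sub>m n)"

text \<open>\<open>p(X)\<close>, with the sum over the words of \<open>p\<close> formed entrywise.\<close>
definition nc_eval :: "nat \<Rightarrow> ('v \<Rightarrow> real mat) \<Rightarrow> 'v ncpoly \<Rightarrow> real mat" where
  "nc_eval n X p = mat n n (\<lambda>ij.
     \<Sum>w\<in>Poly_Mapping.keys p. Poly_Mapping.lookup p w * word_eval n X w $$ ij)"

definition psd_mat :: "nat \<Rightarrow> real mat \<Rightarrow> bool" where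
  "psd_mat n A \<longleftrightarrow> A \<in> sym_mats n \<and> (\<forall>u\<in>carrier_vec n. (A *\<^sub>v u) \<bullet> u \<ge> 0)"

definition relaxed_hessian_positive_at ::
    "nat \<Rightarrow> 'g::finite ncpoly \<Rightarrow> ('g \<Rightarrow> real mat) \<Rightarrow> real vec \<Rightarrow> bool" where
  "relaxed_hessian_positive_at n p X v \<longleftrightarrow>
     (\<forall>\<delta>>0. \<exists>l>0. \<forall>H. (\<forall>j. H j \<in> sym_mats n) \<longrightarrow>
        (nc_eval n (case_sum X H) (relaxed_hessian p l \<delta>) *\<^sub>v v) \<bullet> v \<ge> 0)"

definition nc_convex :: "'g ncpoly \<Rightarrow> bool" where
  "nc_convex p \<longleftrightarrow>
     (\<forall>n X Y t. (\<forall>j. X j \<in> sym_mats n) \<longrightarrow> (\<forall>j. Y j \<in> sym_mats n) \<longrightarrow> 0 \<le> t \<longrightarrow> t \<le> 1 \<longrightarrow>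
        psd_mat n (t \<cdot>\<^sub>m nc_eval n X p + (1 - t) \<cdot>\<^sub>m nc_eval n Y p
                   - nc_eval n (\<lambda>j. t \<cdot>\<^sub>m X j + (1 - t) \<cdot>\<^sub>m Y j) p))"

end

theory Submission
  imports Defs "Jordan_Normal_Form.Determinant"
begin

text \<open>The quadratic form \<open>H \<mapsto> \<langle>p''(X)[H]v, v\<rangle>\<close> depends on \<open>H\<close> only through the vectors \<open>H\<^sub>j X\<^sub>c v\<close>, where
  \<open>c\<close> is a word of length less than \<open>d\<close>. As the vectors \<open>X\<^sub>c v\<close> are linearly independent, a family
  \<open>z\<^sub>j\<^sub>,\<^sub>c\<close> is of the form \<open>H\<^sub>j X\<^sub>c v\<close> with symmetric \<open>H\<^sub>j\<close> iff
  \<open>\<langle>z\<^sub>j\<^sub>,\<^sub>c, X\<^sub>b v\<rangle> = \<langle>X\<^sub>c v, z\<^sub>j\<^sub>,\<^sub>b\<rangle>\<close>. These are fewer than \<open>n\<close> linear conditions, so every family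
  \<open>z\<^sub>j\<^sub>,\<^sub>c = M\<^sub>j\<^sub>,\<^sub>c t\<close> that depends linearly on \<open>t \<in> \<real>\<^sup>n\<close> is realised for some \<open>t \<noteq> 0\<close>. If moreover
  \<open>p'(X)[H]v = 0\<close> for such families, positivity of the relaxed Hessian makes the Hessian nonnegative at
  this \<open>t\<close>. The antidiagonal of the Hessian consists of the top degree coefficients of \<open>p\<close>; for
  \<open>d \<ge> 3\<close> it lies off the diagonal, so \<open>M\<close> can be chosen with value \<open>- \<bar>t\<bar>\<^sup>2\<close>, a contradiction. For
  \<open>d = 2\<close> scalar \<open>M\<close> show that the matrix of quadratic coefficients is positive semidefinite.\<close>

section \<open>Evaluation as a linear functional on polynomials\<close>

text \<open>The linear extension of \<open>f\<close> from words to polynomials. For fixed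
  \<open>x\<close> and \<open>y\<close> the inner product of \<open>p(X) x\<close> with
  \<open>y\<close> has this form, so identities between evaluations reduce to identities between
  words.\<close>

definition wsum :: "('v list \<Rightarrow> real) \<Rightarrow> 'v ncpoly \<Rightarrow> real" where
  "wsum f p = (\<Sum>w\<in>Poly_Mapping.keys p. Poly_Mapping.lookup p w * f w)"

lemma wsum_superset:
  assumes "finite S" "Poly_Mapping.keys p \<subseteq> S"
  shows "wsum f p = (\<Sum>w\<in>S. Poly_Mapping.lookup p w * f w)"
  unfolding wsum_def using assms by (intro sum.mono_neutral_left) (auto simp: in_keys_iff)

lemma wsum_cong: "(\<And>w. f w = h w) \<Longrightarrow> wsum f p = wsum h p"
  by (simp add: wsum_def)

lemma wsum_zero [simp]: "wsum f 0 = 0"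
  by (simp add: wsum_def)

lemma wsum_single [simp]: "wsum f (Poly_Mapping.single w c) = c * f w"
  by (simp add: wsum_def)

lemma wsum_add: "wsum f (p + q) = wsum f p + wsum f q"
proof -
  define S where "S = Poly_Mapping.keys p \<union> Poly_Mapping.keys q"
  have "finite S" "Poly_Mapping.keys p \<subseteq> S" "Poly_Mapping.keys q \<subseteq> S"
    "Poly_Mapping.keys (p + q) \<subseteq> S"
    using Poly_Mapping.keys_add[of p q] by (auto simp: S_def)
  then show ?thesis
    by (simp add: wsum_superset[of S] lookup_add algebra_simps sum.distrib)
qed

lemma wsum_sum: "wsum f (\<Sum>k\<in>K. q k) = (\<Sum>k\<in>K. wsum f (q k))"
  by (induction K rule: infinite_finite_induct) (simp_all add: wsum_add)

lemma ncpoly_eq_sum_single: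
  "p = (\<Sum>w\<in>Poly_Mapping.keys p. Poly_Mapping.single w (Poly_Mapping.lookup p w))"
  by (intro poly_mapping_eqI)
     (auto simp: lookup_sum lookup_single when_def in_keys_iff)

text \<open>Both sides are bilinear in \<open>p\<close> and \<open>q\<close>, so it suffices to
  expand both into single words.\<close>

lemma wsum_mult: "wsum f (p * q) = wsum (\<lambda>u. wsum (\<lambda>w. f (u @ w)) q) p"
proof -
  let ?l = Poly_Mapping.lookup and ?k = Poly_Mapping.keys
  have "p * q = (\<Sum>u\<in>?k p. \<Sum>w\<in>?k q. Poly_Mapping.single (u @ w) (?l p u * ?l q w))"
    by (subst ncpoly_eq_sum_single[of p], subst ncpoly_eq_sum_single[of q])
       (simp add: sum_product mult_single plus_list_def)
  then show ?thesis
    by (simp add: wsum_sum) (simp add: wsum_def sum_distrib_left mult_ac)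
qed

lemma wsum_adj: "wsum f (nc_adj p) = wsum (\<lambda>w. f (rev w)) p"
proof -
  have k: "Poly_Mapping.keys (nc_adj p) = rev ` Poly_Mapping.keys p"
    by (force simp: in_keys_iff lookup_nc_adj image_iff intro: bexI[of _ "rev _"])
  show ?thesis
    unfolding wsum_def k by (subst sum.reindex) (auto simp: lookup_nc_adj inj_on_def)
qed

text \<open>With an indicator function as \<open>f\<close>, the rules for \<open>wsum\<close> also
  compute coefficients, in particular those of products.\<close>

lemma lookup_eq_wsum: "Poly_Mapping.lookup p u = wsum (\<lambda>w. if w = u then 1 else 0) p"
proof -
  have "wsum (\<lambda>w. if w = u then 1 else 0) p
      = (\<Sum>w\<in>Poly_Mapping.keys p. if w = u then Poly_Mapping.lookup p w else 0)"
    unfolding wsum_def by (intro sum.cong) auto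
  also have "\<dots> = Poly_Mapping.lookup p u"
    by (simp add: in_keys_iff)
  finally show ?thesis by simp
qed

section \<open>Inner products with values of words and polynomials\<close>

lemma scalar_prod_mult_mat_vec:
  fixes A :: "real mat"
  assumes "A \<in> carrier_mat n m" "x \<in> carrier_vec m" "y \<in> carrier_vec n"
  shows "(A *\<^sub>v x) \<bullet> y = (\<Sum>i<n. \<Sum>j<m. A $$ (i,j) * (x $ j * y $ i))"
  using assms
  by (auto simp: scalar_prod_def mult_mat_vec_def sum_distrib_left sum_distrib_right
      atLeast0LessThan mult_ac intro!: sum.cong)

lemma scalar_prod_mult_transpose:
  fixes A :: "real mat"
  assumes "A \<in> carrier_mat n m" "x \<in> carrier_vec m" "y \<in> carrier_vec n"
  shows "(A *\<^sub>v x) \<bullet> y = x \<bullet> (A\<^sup>T *\<^sub>v y)"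
proof -
  have "(A *\<^sub>v x) \<bullet> y = (A\<^sup>T *\<^sub>v y) \<bullet> x"
    using assms
    by (simp add: scalar_prod_mult_mat_vec[of A n m] scalar_prod_mult_mat_vec[of "A\<^sup>T" m n])
       (subst sum.swap, intro sum.cong refl, auto simp: mult_ac)
  also have "\<dots> = x \<bullet> (A\<^sup>T *\<^sub>v y)"
    using assms by (intro comm_scalar_prod[of _ m]) auto
  finally show ?thesis .
qed

lemma word_eval_Nil [simp]: "word_eval n X [] = 1\<^sub>m n"
  and word_eval_Cons [simp]: "word_eval n X (j # w) = X j * word_eval n X w"
  by (simp_all add: word_eval_def)

lemma word_eval_carrier [simp]:
  assumes "\<And>j. X j \<in> carrier_mat n n"
  shows "word_eval n X w \<in> carrier_mat n n"
  by (induction w) (auto intro: assms mult_carrier_mat)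

lemma word_eval_append:
  assumes "\<And>j. X j \<in> carrier_mat n n"
  shows "word_eval n X (u @ w) = word_eval n X u * word_eval n X w"
proof (induction u)
  case Nil
  then show ?case using word_eval_carrier[where X = X and w = w, OF assms] by simp
next
  case (Cons j u)
  then show ?case
    by (simp add: assoc_mult_mat[OF assms word_eval_carrier word_eval_carrier] assms)
qed

lemma sym_matsD:
  assumes "A \<in> sym_mats n"
  shows "A \<in> carrier_mat n n" "A\<^sup>T = A"
  using assms by (auto simp: sym_mats_def)

lemma word_eval_transpose:
  assumes "\<And>j. X j \<in> sym_mats n"
  shows "(word_eval n X w)\<^sup>T = word_eval n X (rev w)"
proof -
  have c: "X j \<in> carrier_mat n n" "(X j)\<^sup>T = X j" for j
    using sym_matsD[OF assms] by auto
  note cw = word_eval_carrier[of X n, OF c(1)]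
  show ?thesis
  proof (induction w)
    case (Cons j w)
    have "(word_eval n X (j # w))\<^sup>T = word_eval n X (rev w) * X j"
      using transpose_mult[OF c(1)[of j] cw[of w]] Cons c by simp
    then show ?case
      using word_eval_append[where X = X and u = "rev w" and w = "[j]", OF c(1)] c(1)[of j] by simp
  qed simp
qed

lemma nc_eval_carrier [simp]: "nc_eval n X p \<in> carrier_mat n n"
  by (simp add: nc_eval_def)

text \<open>Turns an entrywise sum, the form in which \<open>nc_eval\<close> is given, into a sum of
  numbers. General \<open>A\<close> and \<open>K\<close> are allowed because later test matrices are
  built in the same way.\<close>

lemma scalar_prod_mat_sum:
  fixes A :: "'k \<Rightarrow> real mat"
  assumes "\<And>k. k \<in> K \<Longrightarrow> A k \<in> carrier_mat n n" "x \<in> carrier_vec n" "y \<in> carrier_vec n"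
  shows "(mat n n (\<lambda>ij. \<Sum>k\<in>K. a k * A k $$ ij) *\<^sub>v x) \<bullet> y = (\<Sum>k\<in>K. a k * ((A k *\<^sub>v x) \<bullet> y))"
proof -
  have "(mat n n (\<lambda>ij. \<Sum>k\<in>K. a k * A k $$ ij) *\<^sub>v x) \<bullet> y
      = (\<Sum>i<n. \<Sum>j<n. \<Sum>k\<in>K. a k * (A k $$ (i,j) * (x $ j * y $ i)))"
    using assms by (simp add: scalar_prod_mult_mat_vec[of _ n n] sum_distrib_right sum_distrib_left mult_ac)
  also have "\<dots> = (\<Sum>i<n. \<Sum>k\<in>K. \<Sum>j<n. a k * (A k $$ (i,j) * (x $ j * y $ i)))"
    by (intro sum.cong refl sum.swap)
  also have "\<dots> = (\<Sum>k\<in>K. \<Sum>i<n. \<Sum>j<n. a k * (A k $$ (i,j) * (x $ j * y $ i)))"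
    by (rule sum.swap)
  finally show ?thesis
    using assms by (simp add: scalar_prod_mult_mat_vec[of _ n n] sum_distrib_left)
qed

lemma scalar_prod_nc_eval:
  assumes "\<And>j. X j \<in> carrier_mat n n" "x \<in> carrier_vec n" "y \<in> carrier_vec n"
  shows "(nc_eval n X p *\<^sub>v x) \<bullet> y = wsum (\<lambda>w. (word_eval n X w *\<^sub>v x) \<bullet> y) p"
  unfolding nc_eval_def wsum_def using assms by (intro scalar_prod_mat_sum) auto

lemma scalar_prod_nc_eval_mult:
  assumes X: "\<And>j. X j \<in> carrier_mat n n" and x: "x \<in> carrier_vec n" and y: "y \<in> carrier_vec n"
  shows "(nc_eval n X (p * q) *\<^sub>v x) \<bullet> y = (nc_eval n X p *\<^sub>v (nc_eval n X q *\<^sub>v x)) \<bullet> y"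
proof -
  note cw = word_eval_carrier[of X n, OF X]
  have q: "nc_eval n X q *\<^sub>v x \<in> carrier_vec n" using x by (intro mult_mat_vec_carrier) auto
  \<comment> \<open>Moving the outer word to \<open>y\<close> by transposition leaves an inner sum
    over \<open>q\<close> against a fixed vector, which is again an evaluation.\<close>
  have "(nc_eval n X (p * q) *\<^sub>v x) \<bullet> y
      = wsum (\<lambda>u. wsum (\<lambda>w. (word_eval n X w *\<^sub>v x) \<bullet> ((word_eval n X u)\<^sup>T *\<^sub>v y)) q) p"
    unfolding scalar_prod_nc_eval[OF X x y] wsum_mult word_eval_append[OF X]
    by (intro wsum_cong, subst assoc_mult_mat_vec[OF cw cw x])
       (rule scalar_prod_mult_transpose[OF cw mult_mat_vec_carrier[OF cw x] y])
  also have "\<dots> = wsum (\<lambda>u. (nc_eval n X q *\<^sub>v x) \<bullet> ((word_eval n X u)\<^sup>T *\<^sub>v y)) p"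
    using x y cw by (intro wsum_cong scalar_prod_nc_eval[symmetric] X mult_mat_vec_carrier) auto
  also have "\<dots> = wsum (\<lambda>u. (word_eval n X u *\<^sub>v (nc_eval n X q *\<^sub>v x)) \<bullet> y) p"
    using q y cw by (intro wsum_cong scalar_prod_mult_transpose[symmetric]) auto
  also have "\<dots> = (nc_eval n X p *\<^sub>v (nc_eval n X q *\<^sub>v x)) \<bullet> y"
    by (rule scalar_prod_nc_eval[OF X q y, symmetric])
  finally show ?thesis .
qed

text \<open>For symmetric \<open>X j\<close> the value of the reversed word is the transpose of the
  value of the word.\<close>

lemma scalar_prod_nc_eval_adj:
  assumes X: "\<And>j. X j \<in> sym_mats n" and x: "x \<in> carrier_vec n" and y: "y \<in> carrier_vec n"
  shows "(nc_eval n X (nc_adj p) *\<^sub>v x) \<bullet> y = x \<bullet> (nc_eval n X p *\<^sub>v y)"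
proof -
  have c: "X j \<in> carrier_mat n n" for j using sym_matsD[OF X] by auto
  note cw = word_eval_carrier[of X n, OF c]
  have e: "(word_eval n X (rev w) *\<^sub>v x) \<bullet> y = (word_eval n X w *\<^sub>v y) \<bullet> x" for w
  proof -
    have "(word_eval n X (rev w) *\<^sub>v x) \<bullet> y = x \<bullet> (word_eval n X w *\<^sub>v y)"
      using scalar_prod_mult_transpose[OF cw x y, of "rev w"] word_eval_transpose[of X n "rev w", OF X]
      by simp
    also have "\<dots> = (word_eval n X w *\<^sub>v y) \<bullet> x"
      using x y cw by (intro comm_scalar_prod[of _ n] mult_mat_vec_carrier[of _ n n]) auto
    finally show ?thesis .
  qed
  have "(nc_eval n X (nc_adj p) *\<^sub>v x) \<bullet> y = (nc_eval n X p *\<^sub>v y) \<bullet> x"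
    by (simp add: scalar_prod_nc_eval[OF c] x y wsum_adj e)
  also have "\<dots> = x \<bullet> (nc_eval n X p *\<^sub>v y)"
    using x y by (intro comm_scalar_prod[of _ n] mult_mat_vec_carrier[of _ n n]) auto
  finally show ?thesis .
qed

lemma scalar_prod_self_nonneg: "x \<bullet> x \<ge> (0 :: real)"
  by (simp add: scalar_prod_def sum_nonneg)

lemma scalar_prod_self_eq_0_iff:
  fixes x :: "real Matrix.vec"
  assumes "x \<in> carrier_vec n"
  shows "x \<bullet> x = 0 \<longleftrightarrow> x = 0\<^sub>v n"
proof
  assume "x \<bullet> x = 0"
  then have "\<forall>i\<in>{0..<dim_vec x}. x $ i * x $ i = 0"
    unfolding scalar_prod_def by (subst (asm) sum_nonneg_eq_0_iff) auto
  then show "x = 0\<^sub>v n" using assms by (intro eq_vecI) auto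
qed (use assms in simp)

section \<open>Coefficients of the directional derivatives\<close>

lemma lookup_nc_const_mult: "Poly_Mapping.lookup (nc_const c * q) u = c * Poly_Mapping.lookup q u"
  unfolding lookup_eq_wsum[of _ u] nc_const_def wsum_mult by simp

lemma lookup_single_var_mult:
  fixes q :: "'v ncpoly"
  shows "Poly_Mapping.lookup (Poly_Mapping.single [x] c * q) u
    = (case u of [] \<Rightarrow> 0 | y # u' \<Rightarrow> if y = x then c * Poly_Mapping.lookup q u' else 0)"
proof -
  have "Poly_Mapping.lookup (Poly_Mapping.single [x] c * q) u
      = c * wsum (\<lambda>w. if x # w = u then 1 else 0) q"
    by (subst lookup_eq_wsum) (simp add: wsum_mult)
  moreover have "wsum (\<lambda>w. 0) q = 0" by (simp add: wsum_def)
  ultimately show ?thesis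
    by (cases u) (auto simp: lookup_eq_wsum[of q])
qed

lemma lookup_le_degree:
  assumes "Poly_Mapping.lookup p w \<noteq> 0"
  shows "length w \<le> nc_degree p"
  using assms unfolding nc_degree_def by (intro Max_ge) (auto simp: in_keys_iff)

definition forget_dir :: "('g + 'g) list \<Rightarrow> 'g list" where
  "forget_dir u = map (case_sum (\<lambda>j. j) (\<lambda>j. j)) u"

definition dir_count :: "('g + 'g) list \<Rightarrow> nat" where
  "dir_count u = length (filter (\<lambda>x. \<not> isl x) u)"

lemma forget_dir_simps [simp]:
  "forget_dir [] = []" "forget_dir (Inl j # u) = j # forget_dir u"
  "forget_dir (Inr j # u) = j # forget_dir u" "forget_dir (u @ u') = forget_dir u @ forget_dir u'"
  "forget_dir (map Inl w) = w" "length (forget_dir u) = length u"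
  by (simp_all add: forget_dir_def comp_def)

lemma dir_count_simps [simp]:
  "dir_count [] = 0" "dir_count (Inl j # u) = dir_count u"
  "dir_count (Inr j # u) = Suc (dir_count u)" "dir_count (u @ u') = dir_count u + dir_count u'"
  "dir_count (map Inl w) = 0"
  by (simp_all add: dir_count_def filter_map comp_def)

lemma dir_count_eq_0D: "dir_count u = 0 \<Longrightarrow> u = map Inl (forget_dir u)"
proof (induction u)
  case (Cons x u)
  then show ?case by (cases x) auto
qed simp

lemma dir_count_SucD:
  "dir_count u = Suc k \<Longrightarrow> \<exists>a j u'. u = map Inl a @ Inr j # u' \<and> dir_count u' = k"
proof (induction u)
  case (Cons x u)
  show ?case
  proof (cases x)
    case (Inl i)
    then obtain a j u' where "u = map Inl a @ Inr j # u'" "dir_count u' = k" using Cons by auto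
    then show ?thesis using Inl by (intro exI[of _ "i # a"]) auto
  next
    case (Inr i)
    then show ?thesis using Cons.prems by (intro exI[of _ "[]"]) auto
  qed
qed simp

text \<open>In the expanded product over the letters of a word, each letter \<open>j\<close> becomes
  either \<open>Inl j\<close> or \<open>t\<close> times \<open>Inr j\<close>. Thus \<open>u\<close>
  arises only from the word \<open>forget_dir u\<close>, with one factor \<open>t\<close> for each
  direction letter.\<close>

lemma lookup_nc_shift:
  "Poly_Mapping.lookup (nc_shift p t) u = Poly_Mapping.lookup p (forget_dir u) * t ^ dir_count u"
proof -
  define Y :: "'a \<Rightarrow> ('a + 'a) ncpoly"
    where "Y j = Poly_Mapping.single [Inl j] 1 + Poly_Mapping.single [Inr j] t" for j
  have Y: "nc_var (Inl j) + nc_const t * nc_var (Inr j) = Y j" for j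
    by (simp add: Y_def nc_var_def nc_word_def nc_const_def mult_single plus_list_def)
  have prod: "Poly_Mapping.lookup (prod_list (map Y w)) u
      = (if forget_dir u = w then t ^ dir_count u else 0)" for w u
  proof (induction w arbitrary: u)
    case Nil
    then show ?case by (cases u) (auto simp: lookup_one zero_list_def when_def forget_dir_def)
  next
    case (Cons j w)
    show ?case
    proof (cases u)
      case (Cons x u')
      then show ?thesis
        using Cons.IH[of u']
        by (cases x) (auto simp: Y_def distrib_right lookup_add lookup_single_var_mult)
    qed (simp add: Y_def distrib_right lookup_add lookup_single_var_mult)
  qed
  have "Poly_Mapping.lookup (nc_shift p t) u
      = (\<Sum>w\<in>Poly_Mapping.keys p. if w = forget_dir u then Poly_Mapping.lookup p w * t ^ dir_count u else 0)"
    unfolding nc_shift_def nc_subst_def Y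
    unfolding lookup_sum lookup_nc_const_mult prod by (intro sum.cong) auto
  then show ?thesis by (simp add: in_keys_iff)
qed

text \<open>For \<open>m = 0\<close> the truncated exponent \<open>m - 1\<close> is harmless, as the
  factor \<open>real m\<close> vanishes.\<close>

lemma deriv_monomial: "deriv (\<lambda>t::real. c * t ^ m) = (\<lambda>t. (c * real m) * t ^ (m - 1))"
  by (rule ext, rule DERIV_imp_deriv) (auto intro!: derivative_eq_intros)

text \<open>Among the monomials \<open>t ^ m\<close> only \<open>m = 1\<close> has a nonzero
  derivative at 0.\<close>

lemma lookup_nc_dderiv_1:
  "Poly_Mapping.lookup (nc_dderiv 1 p) u
    = (if dir_count u = 1 then Poly_Mapping.lookup p (forget_dir u) else 0)"
  unfolding nc_dderiv.rep_eq lookup_nc_shift One_nat_def funpow.simps o_apply id_apply deriv_monomial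
  by (cases "dir_count u") auto

text \<open>Among the monomials \<open>t ^ m\<close> only \<open>m = 2\<close> has a nonzero second
  derivative at 0, namely 2.\<close>

lemma lookup_nc_dderiv_2:
  "Poly_Mapping.lookup (nc_dderiv 2 p) u
    = (if dir_count u = 2 then 2 * Poly_Mapping.lookup p (forget_dir u) else 0)"
proof -
  have "dir_count u = 0 \<or> dir_count u = 1 \<or> (\<exists>k. dir_count u = Suc (Suc k))"
    by (metis One_nat_def not0_implies_Suc)
  then show ?thesis
    unfolding nc_dderiv.rep_eq lookup_nc_shift numeral_2_eq_2 funpow.simps o_apply id_apply
      deriv_monomial
    by auto
qed

text \<open>A triple \<open>(a, j, c)\<close> is a word \<open>a @ j # c\<close> of length at most
  \<open>d\<close> with one marked letter, the place of the direction; the quintuples of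
  \<open>splits2\<close> mark two letters.\<close>

definition splits1 :: "nat \<Rightarrow> ('g list \<times> 'g \<times> 'g list) set" where
  "splits1 d = {(a, j, c). length a + length c < d}"

definition splits2 :: "nat \<Rightarrow> ('g list \<times> 'g \<times> 'g list \<times> 'g \<times> 'g list) set" where
  "splits2 d = {(a, i, b, j, c). length a + length b + length c + 1 < d}"

lemma finite_words: "finite {w :: 'g::finite list. length w < d}"
  by (rule finite_subset[OF _ finite_lists_length_le[of UNIV d]]) auto

lemma finite_splits1: "finite (splits1 d :: ('g::finite list \<times> 'g \<times> 'g list) set)"
proof (rule finite_subset)
  show "splits1 d \<subseteq> {w :: 'g list. length w < d} \<times> UNIV \<times> {w. length w < d}"
    by (auto simp: splits1_def)
qed (auto simp: finite_words)

lemma finite_splits2: "finite (splits2 d :: ('g::finite list \<times> 'g \<times> 'g list \<times> 'g \<times> 'g list) set)"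
proof (rule finite_subset)
  show "splits2 d \<subseteq> {w :: 'g list. length w < d} \<times> UNIV \<times> {w. length w < d} \<times> UNIV \<times> {w. length w < d}"
    by (auto simp: splits2_def)
qed (auto simp: finite_words)

lemma map_Inl_Inr_eq_iff:
  "map Inl a @ Inr j # u = map Inl a' @ Inr j' # u' \<longleftrightarrow> a = a' \<and> j = j' \<and> u = u'"
proof (induction a arbitrary: a')
  case Nil
  then show ?case by (cases a') auto
next
  case (Cons x a)
  then show ?case by (cases a') auto
qed

lemma map_Inl_inject: "map Inl a = map Inl b \<longleftrightarrow> a = b"
  by (rule inj_map_eq_map) simp

text \<open>Words with exactly one direction letter correspond bijectively to marked words. Those
  with nonzero coefficient have length at most \<open>d\<close>; all other triples contribute
  zero.\<close>

lemma wsum_nc_dderiv_1: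
  fixes p :: "'g::finite ncpoly"
  assumes "nc_degree p \<le> d"
  shows "wsum f (nc_dderiv 1 p) = (\<Sum>(a, j, c)\<in>splits1 d.
    Poly_Mapping.lookup p (a @ j # c) * f (map Inl a @ Inr j # map Inl c))"
proof -
  define h :: "'g list \<times> 'g \<times> 'g list \<Rightarrow> ('g + 'g) list"
    where "h = (\<lambda>(a, j, c). map Inl a @ Inr j # map Inl c)"
  have "Poly_Mapping.keys (nc_dderiv 1 p) \<subseteq> h ` splits1 d"
  proof
    fix u assume "u \<in> Poly_Mapping.keys (nc_dderiv 1 p)"
    then have u: "dir_count u = 1" "Poly_Mapping.lookup p (forget_dir u) \<noteq> 0"
      by (auto simp: in_keys_iff lookup_nc_dderiv_1[unfolded One_nat_def] split: if_splits)
    obtain a j u' where 1: "u = map Inl a @ Inr j # u'" "dir_count u' = 0"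
      using dir_count_SucD[of u 0] u by auto
    define c where "c = forget_dir u'"
    have 2: "u = h (a, j, c)" using 1 dir_count_eq_0D[OF 1(2)] by (simp add: h_def c_def)
    have "length a + length c < d"
      using lookup_le_degree[OF u(2)] assms by (simp add: 2 h_def)
    then show "u \<in> h ` splits1 d" using 2 by (force simp: splits1_def)
  qed
  then have "wsum f (nc_dderiv 1 p)
      = (\<Sum>u\<in>h ` splits1 d. Poly_Mapping.lookup (nc_dderiv 1 p) u * f u)"
    by (intro wsum_superset finite_imageI finite_splits1)
  also have "\<dots> = (\<Sum>(a, j, c)\<in>splits1 d.
      Poly_Mapping.lookup p (a @ j # c) * f (map Inl a @ Inr j # map Inl c))"
    by (subst sum.reindex)
       (auto simp: inj_on_def h_def map_Inl_Inr_eq_iff map_Inl_inject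
          lookup_nc_dderiv_1[unfolded One_nat_def] intro!: sum.cong)
  finally show ?thesis .
qed

lemma wsum_nc_dderiv_2:
  fixes p :: "'g::finite ncpoly"
  assumes "nc_degree p \<le> d"
  shows "wsum f (nc_dderiv 2 p) = (\<Sum>(a, i, b, j, c)\<in>splits2 d.
    2 * Poly_Mapping.lookup p (a @ i # b @ j # c)
      * f (map Inl a @ Inr i # map Inl b @ Inr j # map Inl c))"
proof -
  define h :: "'g list \<times> 'g \<times> 'g list \<times> 'g \<times> 'g list \<Rightarrow> ('g + 'g) list"
    where "h = (\<lambda>(a, i, b, j, c). map Inl a @ Inr i # map Inl b @ Inr j # map Inl c)"
  have "Poly_Mapping.keys (nc_dderiv 2 p) \<subseteq> h ` splits2 d"
  proof
    fix u assume "u \<in> Poly_Mapping.keys (nc_dderiv 2 p)"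
    then have u: "dir_count u = 2" "Poly_Mapping.lookup p (forget_dir u) \<noteq> 0"
      by (auto simp: in_keys_iff lookup_nc_dderiv_2 split: if_splits)
    obtain a i u' where 1: "u = map Inl a @ Inr i # u'" "dir_count u' = 1"
      using dir_count_SucD[of u 1] u by auto
    obtain b j u'' where 2: "u' = map Inl b @ Inr j # u''" "dir_count u'' = 0"
      using dir_count_SucD[of u' 0] 1 by auto
    define c where "c = forget_dir u''"
    have 3: "u = h (a, i, b, j, c)"
      using 1 2(1) dir_count_eq_0D[OF 2(2)] by (simp add: h_def c_def)
    have "length a + length b + length c + 1 < d"
      using lookup_le_degree[OF u(2)] assms by (simp add: 3 h_def)
    then show "u \<in> h ` splits2 d" using 3 by (force simp: splits2_def)
  qed
  then have "wsum f (nc_dderiv 2 p)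
      = (\<Sum>u\<in>h ` splits2 d. Poly_Mapping.lookup (nc_dderiv 2 p) u * f u)"
    by (intro wsum_superset finite_imageI finite_splits2)
  also have "\<dots> = (\<Sum>(a, i, b, j, c)\<in>splits2 d. 2 * Poly_Mapping.lookup p (a @ i # b @ j # c)
      * f (map Inl a @ Inr i # map Inl b @ Inr j # map Inl c))"
    by (subst sum.reindex)
       (auto simp: inj_on_def h_def map_Inl_Inr_eq_iff map_Inl_inject lookup_nc_dderiv_2 intro!: sum.cong)
  finally show ?thesis .
qed

section \<open>Symmetric matrices with prescribed values\<close>

text \<open>Fewer equations than unknowns: padding the coefficient matrix with zero rows to a square
  one makes it singular.\<close>

lemma homogeneous_system_nonzero_solution:
  fixes r :: "'k \<Rightarrow> real Matrix.vec"
  assumes K: "finite K" "card K < n" and r: "\<And>k. k \<in> K \<Longrightarrow> r k \<in> carrier_vec n"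
  obtains t where "t \<in> carrier_vec n" "t \<noteq> 0\<^sub>v n" "\<And>k. k \<in> K \<Longrightarrow> r k \<bullet> t = 0"
proof -
  obtain ks where ks: "set ks = K" "distinct ks" using finite_distinct_list[OF K(1)] by blast
  have len: "length ks < n" using ks K distinct_card by fastforce
  define A where "A = mat n n (\<lambda>(i,j). if i < length ks then r (ks ! i) $ j else 0)"
  have A: "A \<in> carrier_mat n n" by (simp add: A_def)
  \<comment> \<open>The first padding row, which exists because \<open>length ks < n\<close>, puts a
    unit vector into the kernel of the transpose.\<close>
  have "row A (length ks) = 0\<^sub>v n" using len by (intro eq_vecI) (auto simp: A_def)
  moreover have "A\<^sup>T *\<^sub>v unit_vec n (length ks) = row A (length ks)"
    using len A by (intro eq_vecI) (auto simp: scalar_prod_right_unit)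
  ultimately have "det A\<^sup>T = 0"
    using det_0_iff_vec_prod_zero_field[of "A\<^sup>T" n] A len
    by (auto intro!: exI[of _ "unit_vec n (length ks)"])
  then have "det A = 0" using det_transpose[OF A] by simp
  then obtain t where t: "t \<in> carrier_vec n" "t \<noteq> 0\<^sub>v n" "A *\<^sub>v t = 0\<^sub>v n"
    using det_0_iff_vec_prod_zero_field[OF A] by auto
  have "r k \<bullet> t = 0" if k: "k \<in> K" for k
  proof -
    obtain i where i: "i < length ks" "ks ! i = k" using k ks by (auto simp: in_set_conv_nth)
    have "row A i = r k" using i len r[OF k] by (intro eq_vecI) (auto simp: A_def)
    moreover have "(A *\<^sub>v t) $ i = 0" using t(3) i len by simp
    ultimately show ?thesis using i len A by simp
  qed
  with t that show thesis by blast
qed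

text \<open>With the \<open>e c\<close> as columns of \<open>E\<close>, independence makes the Gram
  matrix \<open>G\<close> invertible. Then \<open>F\<close>, the inverse of \<open>G\<close> times
  the transpose of \<open>E\<close>, is a left inverse of \<open>E\<close>, and its rows are dual to
  the \<open>e c\<close>.\<close>

lemma dual_vectors:
  fixes e :: "'c \<Rightarrow> real Matrix.vec"
  assumes C: "finite C" and e: "\<And>c. c \<in> C \<Longrightarrow> e c \<in> carrier_vec n"
    and indep: "\<forall>a. (\<forall>y\<in>carrier_vec n. (\<Sum>c\<in>C. a c * (e c \<bullet> y)) = 0) \<longrightarrow> (\<forall>c\<in>C. a c = 0)"
  shows "\<exists>f. (\<forall>c\<in>C. f c \<in> carrier_vec n) \<and> (\<forall>c\<in>C. \<forall>c'\<in>C. f c \<bullet> e c' = (if c = c' then 1 else 0))"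
proof -
  obtain ks where ks: "set ks = C" "distinct ks" using finite_distinct_list[OF C] by blast
  define m where "m = length ks"
  define E where "E = mat n m (\<lambda>(i,k). e (ks ! k) $ i)"
  have E: "E \<in> carrier_mat n m" and ET: "E\<^sup>T \<in> carrier_mat m n" by (simp_all add: E_def)
  have colE: "col E k = e (ks ! k)" if "k < m" for k
    using that e[of "ks ! k"] ks by (intro eq_vecI) (auto simp: E_def m_def)
  define G where "G = E\<^sup>T * E"
  have G: "G \<in> carrier_mat m m" using E ET by (simp add: G_def)
  have "det G \<noteq> 0"
  proof
    assume "det G = 0"
    then obtain x where x: "x \<in> carrier_vec m" "x \<noteq> 0\<^sub>v m" "G *\<^sub>v x = 0\<^sub>v m"
      using det_0_iff_vec_prod_zero_field[OF G] by auto
    have Ex: "E *\<^sub>v x \<in> carrier_vec n" using E x by (intro mult_mat_vec_carrier) auto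
    \<comment> \<open>A kernel vector of the Gram matrix is already a kernel vector of
      \<open>E\<close>, hence a linear relation between the \<open>e c\<close>.\<close>
    have "(E *\<^sub>v x) \<bullet> (E *\<^sub>v x) = x \<bullet> (G *\<^sub>v x)"
      using scalar_prod_mult_transpose[OF E x(1) Ex] assoc_mult_mat_vec[OF ET E x(1)]
      by (simp add: G_def)
    then have "(E *\<^sub>v x) \<bullet> (E *\<^sub>v x) = 0" unfolding x(3) using x(1) by simp
    then have "E *\<^sub>v x = 0\<^sub>v n" by (rule scalar_prod_self_eq_0_iff[OF Ex, THEN iffD1])
    \<comment> \<open>Reindexes \<open>x\<close> from positions in \<open>ks\<close> to elements of
      \<open>C\<close>; since \<open>ks\<close> is distinct, only one summand can be
      nonzero.\<close>
    define a where "a c = (\<Sum>k<m. if ks ! k = c then x $ k else 0)" for c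
    have a: "a (ks ! k) = x $ k" if "k < m" for k
    proof -
      have "a (ks ! k) = (\<Sum>l<m. if l = k then x $ l else 0)"
        unfolding a_def
      proof (intro sum.cong refl)
        fix l assume "l \<in> {..<m}"
        then have "ks ! l = ks ! k \<longleftrightarrow> l = k"
          using that by (intro nth_eq_iff_index_eq[OF ks(2)]) (simp_all add: m_def)
        then show "(if ks ! l = ks ! k then x $ l else 0) = (if l = k then x $ l else 0)" by simp
      qed
      then show ?thesis using that by simp
    qed
    have "(\<Sum>c\<in>C. a c * (e c \<bullet> y)) = 0" if y: "y \<in> carrier_vec n" for y
    proof -
      have b: "bij_betw (\<lambda>k. ks ! k) {..<m} C"
        using ks by (auto simp: m_def intro: bij_betw_nth)
      have "(\<Sum>c\<in>C. a c * (e c \<bullet> y)) = (\<Sum>k<m. x $ k * (e (ks ! k) \<bullet> y))"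
        using a by (subst sum.reindex_bij_betw[OF b, symmetric]) auto
      also have "\<dots> = (\<Sum>k<m. \<Sum>i<n. E $$ (i,k) * (x $ k * y $ i))"
      proof (intro sum.cong refl)
        fix k assume "k \<in> {..<m}"
        then have "e (ks ! k) \<bullet> y = (\<Sum>i<n. E $$ (i,k) * y $ i)"
          using y by (simp add: scalar_prod_def E_def atLeast0LessThan)
        then show "x $ k * (e (ks ! k) \<bullet> y) = (\<Sum>i<n. E $$ (i,k) * (x $ k * y $ i))"
          by (simp add: sum_distrib_left mult.left_commute)
      qed
      also have "\<dots> = (E *\<^sub>v x) \<bullet> y"
        unfolding scalar_prod_mult_mat_vec[OF E x(1) y] by (rule sum.swap)
      finally show ?thesis using \<open>E *\<^sub>v x = 0\<^sub>v n\<close> y by simp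
    qed
    then have "\<forall>c\<in>C. a c = 0" using indep[THEN spec, of a] by simp
    then have "x $ k = 0" if "k < m" for k using a[OF that] that ks by (auto simp: m_def)
    then have "x = 0\<^sub>v m" using x by (intro eq_vecI) auto
    with x show False by simp
  qed
  define B where "B = (1 / det G) \<cdot>\<^sub>m adj_mat G"
  have B: "B \<in> carrier_mat m m" using adj_mat(1)[OF G] by (simp add: B_def)
  have BG: "B * G = 1\<^sub>m m"
    unfolding B_def mult_smult_assoc_mat[OF adj_mat(1)[OF G] G] adj_mat(3)[OF G]
    using \<open>det G \<noteq> 0\<close> by (intro eq_matI) auto
  define F where "F = B * E\<^sup>T"
  have F: "F \<in> carrier_mat m n" using B ET by (simp add: F_def)
  have FE: "F * E = 1\<^sub>m m" using assoc_mult_mat[OF B ET E] BG by (simp add: F_def G_def)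
  define idx where "idx c = (SOME k. k < m \<and> ks ! k = c)" for c
  have idx: "idx c < m \<and> ks ! idx c = c" if "c \<in> C" for c
    unfolding idx_def
  proof (rule someI_ex)
    show "\<exists>k. k < m \<and> ks ! k = c" using that ks(1) by (auto simp: m_def in_set_conv_nth)
  qed
  show ?thesis
  proof (intro exI[of _ "\<lambda>c. row F (idx c)"] conjI ballI)
    show "row F (idx c) \<in> carrier_vec n" for c using F by auto
    fix c c' assume c: "c \<in> C" "c' \<in> C"
    have l: "idx c < m" "idx c' < m" and iff: "idx c = idx c' \<longleftrightarrow> c = c'"
      using idx[OF c(1)] idx[OF c(2)] by metis+
    have "col E (idx c') = e c'" using colE[OF l(2)] idx[OF c(2)] by simp
    then have "row F (idx c) \<bullet> e c' = (F * E) $$ (idx c, idx c')"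
      using l F E by simp
    also have "\<dots> = (if c = c' then 1 else 0)"
      using l iff by (simp add: FE)
    finally show "row F (idx c) \<bullet> e c' = (if c = c' then 1 else 0)" .
  qed
qed

text \<open>The condition \<open>compat\<close> says that the prescribed map is symmetric on the
  span of the \<open>e c\<close>; a dual family then yields an explicit symmetric matrix on the
  whole space.\<close>

lemma symmetric_extension:
  fixes e z :: "'c \<Rightarrow> real Matrix.vec"
  assumes C: "finite C" and e: "\<And>c. c \<in> C \<Longrightarrow> e c \<in> carrier_vec n"
    and indep: "\<forall>a. (\<forall>y\<in>carrier_vec n. (\<Sum>c\<in>C. a c * (e c \<bullet> y)) = 0) \<longrightarrow> (\<forall>c\<in>C. a c = 0)"
    and z: "\<And>c. c \<in> C \<Longrightarrow> z c \<in> carrier_vec n"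
    and compat: "\<And>c c'. c \<in> C \<Longrightarrow> c' \<in> C \<Longrightarrow> z c \<bullet> e c' = z c' \<bullet> e c"
  shows "\<exists>H\<in>sym_mats n. \<forall>c\<in>C. H *\<^sub>v e c = z c"
proof -
  obtain f where f: "\<And>c. c \<in> C \<Longrightarrow> f c \<in> carrier_vec n"
    and fe: "\<And>c c'. c \<in> C \<Longrightarrow> c' \<in> C \<Longrightarrow> f c \<bullet> e c' = (if c = c' then 1 else 0)"
    using dual_vectors[OF C e indep] by blast
  \<comment> \<open>The correction term cancels the part of the first two sums counted twice on the span of the
    \<open>e c\<close>; it is symmetric precisely because of the compatibility condition.\<close>
  define H where "H = mat n n (\<lambda>(i,k). (\<Sum>c\<in>C. z c $ i * f c $ k) + (\<Sum>c\<in>C. f c $ i * z c $ k)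
      - (\<Sum>c\<in>C. \<Sum>c'\<in>C. (z c \<bullet> e c') * f c $ i * f c' $ k))"
  have H: "H \<in> carrier_mat n n" by (simp add: H_def)
  have "H $$ (k, i) = H $$ (i, k)" if "i < n" "k < n" for i k
  proof -
    have "(\<Sum>c\<in>C. \<Sum>c'\<in>C. (z c \<bullet> e c') * f c $ i * f c' $ k)
        = (\<Sum>c\<in>C. \<Sum>c'\<in>C. (z c' \<bullet> e c) * f c' $ i * f c $ k)"
      by (rule sum.swap)
    also have "\<dots> = (\<Sum>c\<in>C. \<Sum>c'\<in>C. (z c \<bullet> e c') * f c $ k * f c' $ i)"
      using compat by (intro sum.cong refl) (metis mult.assoc mult.commute)
    finally have "(\<Sum>c\<in>C. \<Sum>c'\<in>C. (z c \<bullet> e c') * f c $ i * f c' $ k)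
        = (\<Sum>c\<in>C. \<Sum>c'\<in>C. (z c \<bullet> e c') * f c $ k * f c' $ i)" .
    then show ?thesis using that by (simp add: H_def mult.commute add.commute)
  qed
  then have "H\<^sup>T = H" using H by (intro eq_matI) auto
  then have "H \<in> sym_mats n" using H by (simp add: sym_mats_def)
  moreover have "H *\<^sub>v e b = z b" if b: "b \<in> C" for b
  proof (rule eq_vecI)
    fix i assume "i < dim_vec (z b)"
    then have i: "i < n" using z[OF b] by simp
    have s: "x \<bullet> e b = (\<Sum>k<n. x $ k * e b $ k)" for x
      using e[OF b] by (simp add: scalar_prod_def atLeast0LessThan)
    have "(H *\<^sub>v e b) $ i = (\<Sum>k<n. H $$ (i,k) * e b $ k)"
      using i H e[OF b] by (simp add: scalar_prod_def atLeast0LessThan)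
    also have "\<dots> = (\<Sum>k<n. (\<Sum>c\<in>C. z c $ i * (f c $ k * e b $ k))
        + (\<Sum>c\<in>C. f c $ i * (z c $ k * e b $ k))
        - (\<Sum>c\<in>C. \<Sum>c'\<in>C. (z c \<bullet> e c') * f c $ i * (f c' $ k * e b $ k)))"
      using i by (intro sum.cong refl) (simp add: H_def algebra_simps sum_distrib_left)
    also have "\<dots> = (\<Sum>c\<in>C. z c $ i * (f c \<bullet> e b)) + (\<Sum>c\<in>C. f c $ i * (z c \<bullet> e b))
        - (\<Sum>c\<in>C. \<Sum>c'\<in>C. (z c \<bullet> e c') * f c $ i * (f c' \<bullet> e b))"
    proof -
      have 1: "(\<Sum>k<n. \<Sum>c\<in>C. g c * (h c $ k * e b $ k)) = (\<Sum>c\<in>C. g c * (h c \<bullet> e b))"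
        for g and h :: "'c \<Rightarrow> real Matrix.vec"
        unfolding s sum_distrib_left by (rule sum.swap)
      have "(\<Sum>k<n. \<Sum>c\<in>C. \<Sum>c'\<in>C. (z c \<bullet> e c') * f c $ i * (f c' $ k * e b $ k))
          = (\<Sum>c\<in>C. \<Sum>k<n. \<Sum>c'\<in>C. (z c \<bullet> e c') * f c $ i * (f c' $ k * e b $ k))"
        by (rule sum.swap)
      then show ?thesis by (simp add: sum.distrib sum_subtractf 1)
    qed
    \<comment> \<open>Duality reduces the first sum to \<open>z b $ i\<close> and turns the double
      sum into the second sum, so these two cancel.\<close>
    also have "\<dots> = (\<Sum>c\<in>C. if c = b then z c $ i else 0) + (\<Sum>c\<in>C. f c $ i * (z c \<bullet> e b))
        - (\<Sum>c\<in>C. \<Sum>c'\<in>C. if c' = b then (z c \<bullet> e c') * f c $ i else 0)"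
    proof -
      have "(\<Sum>c\<in>C. z c $ i * (f c \<bullet> e b)) = (\<Sum>c\<in>C. if c = b then z c $ i else 0)"
        using fe[OF _ b] by (intro sum.cong) auto
      moreover have "(\<Sum>c'\<in>C. (z c \<bullet> e c') * f c $ i * (f c' \<bullet> e b))
          = (\<Sum>c'\<in>C. if c' = b then (z c \<bullet> e c') * f c $ i else 0)" for c
        using fe[OF _ b] by (intro sum.cong) auto
      ultimately show ?thesis by simp
    qed
    also have "\<dots> = z b $ i"
      using C b by (simp add: mult.commute)
    finally show "(H *\<^sub>v e b) $ i = z b $ i" .
  qed (use H z[OF b] in auto)
  ultimately show ?thesis by blast
qed

section \<open>The relaxed Hessian at a point\<close>

lemma wsum_nc_const_mult: "wsum f (nc_const c * q) = c * wsum f q"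
  by (simp add: nc_const_def wsum_mult)

lemma nc_adj_word: "nc_adj (nc_word w) = nc_word (rev w)"
proof (rule poly_mapping_eqI)
  fix u :: "'a list"
  have "w = rev u \<longleftrightarrow> rev w = u" by auto
  then show "Poly_Mapping.lookup (nc_adj (nc_word w)) u = Poly_Mapping.lookup (nc_word (rev w)) u"
    by (simp add: lookup_nc_adj nc_word_def lookup_single when_def)
qed

lemma word_eval_map_Inl: "word_eval n (case_sum X H) (map Inl w) = word_eval n X w"
  by (induction w) auto

locale nc_point =
  fixes n :: nat and X :: "'g::finite \<Rightarrow> real mat" and v :: "real Matrix.vec"
  assumes X: "\<And>j. X j \<in> sym_mats n" and v: "v \<in> carrier_vec n"
begin

abbreviation W :: "'g list \<Rightarrow> real mat" where "W w \<equiv> word_eval n X w"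

abbreviation e :: "'g list \<Rightarrow> real Matrix.vec" where "e c \<equiv> W c *\<^sub>v v"

lemma X_carrier [simp]: "X j \<in> carrier_mat n n"
  using sym_matsD(1)[OF X] .

lemma W_carrier [simp]: "W w \<in> carrier_mat n n"
  by (rule word_eval_carrier) simp

lemma W_vec [simp]: "x \<in> carrier_vec n \<Longrightarrow> W w *\<^sub>v x \<in> carrier_vec n"
  by (rule mult_mat_vec_carrier[OF W_carrier])

lemma dim_W [simp]: "dim_row (W w) = n" "dim_col (W w) = n"
  by (rule carrier_matD[OF W_carrier])+

lemma W_transfer:
  assumes "x \<in> carrier_vec n" "y \<in> carrier_vec n"
  shows "(W w *\<^sub>v x) \<bullet> y = x \<bullet> (W (rev w) *\<^sub>v y)"
  using scalar_prod_mult_transpose[OF W_carrier assms, of w] word_eval_transpose[of X n w, OF X]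
  by simp

lemma eval_split1:
  assumes H: "\<And>j. H j \<in> sym_mats n" and x: "x \<in> carrier_vec n"
  shows "word_eval n (case_sum X H) (map Inl a @ Inr j # map Inl c) *\<^sub>v x
    = W a *\<^sub>v (H j *\<^sub>v (W c *\<^sub>v x))"
proof -
  have Hc: "H j \<in> carrier_mat n n" for j using sym_matsD(1)[OF H] .
  have Z: "case_sum X H k \<in> carrier_mat n n" for k using Hc by (cases k) auto
  show ?thesis
    by (simp add: word_eval_append[where X = "case_sum X H", OF Z] word_eval_map_Inl
        assoc_mult_mat_vec[OF W_carrier mult_carrier_mat[OF Hc W_carrier] x]
        assoc_mult_mat_vec[OF Hc W_carrier x])
qed

text \<open>The prefix \<open>a\<close> and the first direction letter move to the second argument
  by symmetry, which reverses \<open>a\<close>. Hence \<open>H\<close> enters only through vectors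
  \<open>H j *\<^sub>v e c\<close>.\<close>

lemma eval_split2:
  assumes H: "\<And>j. H j \<in> sym_mats n"
  shows "(word_eval n (case_sum X H) (map Inl a @ Inr i # map Inl b @ Inr j # map Inl c) *\<^sub>v v) \<bullet> v
    = (W b *\<^sub>v (H j *\<^sub>v e c)) \<bullet> (H i *\<^sub>v e (rev a))"
proof -
  have Hc: "H j \<in> carrier_mat n n" for j using sym_matsD(1)[OF H] .
  have Hv: "H j *\<^sub>v x \<in> carrier_vec n" if "x \<in> carrier_vec n" for j x
    using that by (rule mult_mat_vec_carrier[OF Hc])
  have Z: "case_sum X H k \<in> carrier_mat n n" for k using Hc by (cases k) auto
  note Zc = word_eval_carrier[where X = "case_sum X H", OF Z]
  let ?r = "W b *\<^sub>v (H j *\<^sub>v e c)"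
  have r: "?r \<in> carrier_vec n" using v Hv by simp
  have "word_eval n (case_sum X H) (map Inl a @ Inr i # map Inl b @ Inr j # map Inl c)
      = W a * (H i * word_eval n (case_sum X H) (map Inl b @ Inr j # map Inl c))"
    by (simp add: word_eval_append[where X = "case_sum X H" and u = "map Inl a", OF Z] word_eval_map_Inl)
  then have "word_eval n (case_sum X H) (map Inl a @ Inr i # map Inl b @ Inr j # map Inl c) *\<^sub>v v
      = W a *\<^sub>v (H i *\<^sub>v ?r)"
    by (simp only: assoc_mult_mat_vec[OF W_carrier mult_carrier_mat[OF Hc Zc] v]
        assoc_mult_mat_vec[OF Hc Zc v] eval_split1[OF H v])
  moreover have "(W a *\<^sub>v (H i *\<^sub>v ?r)) \<bullet> v = ?r \<bullet> (H i *\<^sub>v e (rev a))"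
    using W_transfer[OF Hv[OF r] v, of a i] scalar_prod_mult_transpose[OF Hc r W_vec[OF v], of i "rev a"]
      sym_matsD(2)[OF H, of i]
    by simp
  ultimately show ?thesis by simp
qed

lemma eval_relaxed_hessian:
  fixes p :: "'g ncpoly"
  assumes H: "\<And>j. H j \<in> sym_mats n"
  defines "y \<equiv> nc_eval n (case_sum X H) (nc_dderiv 1 p) *\<^sub>v v"
  shows "(nc_eval n (case_sum X H) (relaxed_hessian p l \<delta>) *\<^sub>v v) \<bullet> v
    = (\<Sum>(a, i, b, j, c)\<in>splits2 (nc_degree p). 2 * Poly_Mapping.lookup p (a @ i # b @ j # c)
        * ((W b *\<^sub>v (H j *\<^sub>v e c)) \<bullet> (H i *\<^sub>v e (rev a))))
      + \<delta> * (\<Sum>j\<in>UNIV. \<Sum>m\<in>{m. length m < nc_degree p}. (H j *\<^sub>v e m) \<bullet> (H j *\<^sub>v e m))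
      + l * (y \<bullet> y)"
proof -
  define F where "F w = (word_eval n (case_sum X H) w *\<^sub>v v) \<bullet> v" for w
  have S: "case_sum X H k \<in> sym_mats n" for k using H X by (cases k) auto
  have Z: "case_sum X H k \<in> carrier_mat n n" for k using sym_matsD(1)[OF S] .
  have ev: "(nc_eval n (case_sum X H) q *\<^sub>v v) \<bullet> v = wsum F q" for q
    unfolding F_def by (rule scalar_prod_nc_eval[OF Z v v])
  have F2: "F (map Inl a @ Inr i # map Inl b @ Inr j # map Inl c)
      = (W b *\<^sub>v (H j *\<^sub>v e c)) \<bullet> (H i *\<^sub>v e (rev a))" for a i b j c
    unfolding F_def by (rule eval_split2[OF H])
  \<comment> \<open>Each relaxation summand is a word with two marked letters and empty middle part,
    so \<open>F2\<close> evaluates it to a squared norm.\<close>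
  have sq: "nc_adj (nc_word (map Inl m)) * nc_var (Inr j) ^ 2 * nc_word (map Inl m)
      = nc_word (map Inl (rev m) @ Inr j # map Inl [] @ Inr j # map Inl m)" for m j
    by (simp add: nc_adj_word) (simp add: nc_var_def nc_word_def power2_eq_square mult_single plus_list_def rev_map)
  have Fsq: "wsum F (nc_adj (nc_word (map Inl m)) * nc_var (Inr j) ^ 2 * nc_word (map Inl m))
      = (H j *\<^sub>v e m) \<bullet> (H j *\<^sub>v e m)" for m j
  proof -
    have "H j *\<^sub>v e m \<in> carrier_vec n"
      using sym_matsD(1)[OF H] v by (intro mult_mat_vec_carrier[of _ n n]) auto
    moreover have "wsum F (nc_word w) = F w" for w by (simp add: nc_word_def)
    ultimately show ?thesis by (simp only: sq F2) simp
  qed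
  have y: "y \<in> carrier_vec n" unfolding y_def using v by (intro mult_mat_vec_carrier[of _ n n]) auto
  have "wsum F (nc_adj (nc_dderiv 1 p) * nc_dderiv 1 p) = y \<bullet> y"
    unfolding ev[symmetric] scalar_prod_nc_eval_mult[where X = "case_sum X H", OF Z v v]
      y_def[symmetric] scalar_prod_nc_eval_adj[where X = "case_sum X H", OF S y v] ..
  then show ?thesis
    unfolding ev relaxed_hessian_def wsum_add wsum_nc_const_mult wsum_sum Fsq
      wsum_nc_dderiv_2[OF order_refl] F2 by simp
qed

text \<open>The vectors \<open>M j c *\<^sub>v t\<close> can be realised as \<open>H j *\<^sub>v e c\<close> iff the \<open>CARD('g) * \<nu> (\<nu> - 1) / 2\<close>
  symmetry conditions hold, which are linear in \<open>t\<close>. As \<open>t\<close> and \<open>H\<close> depend neither on \<open>\<delta>\<close> nor on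
  \<open>\<lambda>\<close>, letting \<open>\<delta>\<close> tend to 0 removes the relaxation.\<close>

lemma nonneg_on_kernel_of_derivative:
  fixes p :: "'g ncpoly" and M :: "'g \<Rightarrow> 'g list \<Rightarrow> real mat"
  defines "d \<equiv> nc_degree p"
  assumes indep: "\<not> (\<exists>q :: 'g ncpoly. q \<noteq> 0 \<and> nc_degree q < d \<and> nc_eval n X q *\<^sub>v v = 0\<^sub>v n)"
    and pos: "relaxed_hessian_positive_at n p X v"
    and n: "CARD('g) * (\<nu> * (\<nu> - 1) div 2) < n" and \<nu>: "\<nu> = card {w :: 'g list. length w < d}"
    and M: "\<And>j c. M j c \<in> carrier_mat n n"
    and ker: "\<And>t y. t \<in> carrier_vec n \<Longrightarrow> y \<in> carrier_vec n \<Longrightarrow>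
      (\<Sum>(a, j, c)\<in>splits1 d. Poly_Mapping.lookup p (a @ j # c) * ((W a *\<^sub>v (M j c *\<^sub>v t)) \<bullet> y)) = 0"
  shows "\<exists>t\<in>carrier_vec n. t \<noteq> 0\<^sub>v n \<and>
    (\<Sum>(a, i, b, j, c)\<in>splits2 d. Poly_Mapping.lookup p (a @ i # b @ j # c)
        * ((W b *\<^sub>v (M j c *\<^sub>v t)) \<bullet> (M i (rev a) *\<^sub>v t))) \<ge> 0"
proof -
  define C where "C = {w :: 'g list. length w < d}"
  have C: "finite C" unfolding C_def by (rule finite_words)
  have ev: "e c \<in> carrier_vec n" for c using v by simp
  have Mv: "M j c *\<^sub>v x \<in> carrier_vec n" if "x \<in> carrier_vec n" for j c x
    using that by (rule mult_mat_vec_carrier[OF M])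
  \<comment> \<open>A linear relation between the vectors \<open>e c\<close> is the coefficient list
    of a polynomial of degree less than \<open>d\<close> that annihilates \<open>v\<close>.\<close>
  have lin_indep: "\<forall>c\<in>C. a c = 0"
    if a: "\<forall>y\<in>carrier_vec n. (\<Sum>c\<in>C. a c * (e c \<bullet> y)) = 0" for a
  proof (rule ccontr)
    assume "\<not> (\<forall>c\<in>C. a c = 0)"
    then obtain c0 where c0: "c0 \<in> C" "a c0 \<noteq> 0" by blast
    define q :: "'g ncpoly" where "q = (\<Sum>c\<in>C. Poly_Mapping.single c (a c))"
    have l: "Poly_Mapping.lookup q w = (if w \<in> C then a w else 0)" for w
      using C by (simp add: q_def lookup_sum lookup_single when_def)
    have "q \<noteq> 0" using l[of c0] c0 by auto
    moreover have "nc_degree q < d"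
      using c0 l unfolding nc_degree_def C_def by (auto simp: in_keys_iff split: if_splits)
    moreover have "nc_eval n X q *\<^sub>v v = 0\<^sub>v n"
    proof (rule eq_vecI)
      fix i assume "i < dim_vec (0\<^sub>v n :: real Matrix.vec)"
      then have i: "i < n" by simp
      have "(nc_eval n X q *\<^sub>v v) \<bullet> unit_vec n i = 0"
        unfolding scalar_prod_nc_eval[where X = X, OF X_carrier v unit_vec_carrier]
        unfolding q_def wsum_sum wsum_single by (rule a[rule_format]) simp
      then show "(nc_eval n X q *\<^sub>v v) $ i = 0\<^sub>v n $ i"
        using i v by (subst (asm) scalar_prod_right_unit[of i n]) (auto simp: nc_eval_def)
    qed (simp add: nc_eval_def)
    ultimately show False using indep by blast
  qed
  obtain cs where cs: "set cs = C" "distinct cs" using finite_distinct_list[OF C] by blast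
  have len: "length cs = \<nu>" using distinct_card[OF cs(2)] by (simp add: cs(1) \<nu> C_def)
  \<comment> \<open>One equation for each variable and each unordered pair of distinct words; the
    symmetry condition for a word paired with itself is trivial.\<close>
  define K where "K = (UNIV :: 'g set) \<times> (SIGMA l:{..<\<nu>}. {..<l})"
  have "card K = CARD('g) * (\<Sum>l<\<nu>. l)"
    unfolding K_def card_cartesian_product by (subst card_SigmaI) auto
  also have "(\<Sum>l<\<nu>. l) = \<nu> * (\<nu> - 1) div 2"
    using gauss_sum_nat[of "\<nu> - 1"]
    by (cases \<nu>) (auto simp: lessThan_Suc_atMost atMost_atLeast0 mult.commute)
  finally have K: "finite K" "card K < n" using n by (auto simp: K_def)
  \<comment> \<open>The coefficient vector of a symmetry condition, obtained by moving the matrices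
    \<open>M\<close> away from the unknown \<open>t\<close>.\<close>
  define r where "r = (\<lambda>(j, l, k). (M j (cs ! k))\<^sup>T *\<^sub>v e (cs ! l) - (M j (cs ! l))\<^sup>T *\<^sub>v e (cs ! k))"
  have MTv: "(M j c)\<^sup>T *\<^sub>v x \<in> carrier_vec n" if "x \<in> carrier_vec n" for j c x
    using that M[of j c] by (intro mult_mat_vec_carrier[of _ n n]) auto
  have "r k \<in> carrier_vec n" for k
    unfolding r_def by (cases k) (auto intro!: minus_carrier_vec MTv ev)
  then obtain t where t: "t \<in> carrier_vec n" "t \<noteq> 0\<^sub>v n" and rt: "\<And>k. k \<in> K \<Longrightarrow> r k \<bullet> t = 0"
    using homogeneous_system_nonzero_solution[OF K, of r] by blast
  have adj: "(M j c *\<^sub>v t) \<bullet> e c' = ((M j c)\<^sup>T *\<^sub>v e c') \<bullet> t" for j c c'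
    using scalar_prod_mult_transpose[OF M t(1) ev] comm_scalar_prod[OF t(1) MTv[OF ev]] by simp
  have lt: "(M j (cs ! k) *\<^sub>v t) \<bullet> e (cs ! l) = (M j (cs ! l) *\<^sub>v t) \<bullet> e (cs ! k)"
    if "k < l" "l < \<nu>" for j k l
  proof -
    have "r (j, l, k) \<bullet> t = 0" using that by (intro rt) (auto simp: K_def)
    then show ?thesis
      using minus_scalar_prod_distrib[OF MTv[OF ev] MTv[OF ev] t(1)] by (simp add: r_def adj)
  qed
  have compat: "(M j c *\<^sub>v t) \<bullet> e c' = (M j c' *\<^sub>v t) \<bullet> e c" if "c \<in> C" "c' \<in> C" for j c c'
  proof -
    obtain k l where "k < \<nu>" "l < \<nu>" "c = cs ! k" "c' = cs ! l"
      using \<open>c \<in> C\<close> \<open>c' \<in> C\<close> cs(1) len by (metis in_set_conv_nth)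
    then show ?thesis using lt[of k l j] lt[of l k j] by (cases k l rule: linorder_cases) auto
  qed
  have "\<exists>H\<in>sym_mats n. \<forall>c\<in>C. H *\<^sub>v e c = M j c *\<^sub>v t" for j
  proof (rule symmetric_extension[OF C])
    show "\<forall>a. (\<forall>y\<in>carrier_vec n. (\<Sum>c\<in>C. a c * (e c \<bullet> y)) = 0) \<longrightarrow> (\<forall>c\<in>C. a c = 0)"
      using lin_indep by (intro allI impI)
  qed (rule ev, rule Mv[OF t(1)], rule compat)
  then obtain H where H: "\<And>j. H j \<in> sym_mats n"
    and He: "\<And>j c. c \<in> C \<Longrightarrow> H j *\<^sub>v e c = M j c *\<^sub>v t"
    by metis
  define y where "y = nc_eval n (case_sum X H) (nc_dderiv 1 p) *\<^sub>v v"
  have Z: "case_sum X H k \<in> carrier_mat n n" for k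
    using sym_matsD(1)[OF H] by (cases k) auto
  have y: "y \<in> carrier_vec n" unfolding y_def using v by (intro mult_mat_vec_carrier[of _ n n]) auto
  \<comment> \<open>Testing \<open>ker\<close> against \<open>y\<close> itself shows that
    \<open>p'(X)[H]v\<close> vanishes, so the term with \<open>l\<close> disappears whatever
    \<open>l\<close> is.\<close>
  have "y \<bullet> y = (\<Sum>(a, j, c)\<in>splits1 d. Poly_Mapping.lookup p (a @ j # c) * ((W a *\<^sub>v (H j *\<^sub>v e c)) \<bullet> y))"
    unfolding d_def
    by (subst y_def) (simp only: scalar_prod_nc_eval[where X = "case_sum X H", OF Z v y]
        wsum_nc_dderiv_1[OF order_refl] eval_split1[OF H v])
  also have "\<dots> = 0"
    unfolding ker[OF t(1) y, symmetric]
    by (intro sum.cong) (auto simp: splits1_def He C_def)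
  finally have yy: "y \<bullet> y = 0" .
  define Q where "Q = (\<Sum>(a, i, b, j, c)\<in>splits2 d. Poly_Mapping.lookup p (a @ i # b @ j # c)
        * ((W b *\<^sub>v (M j c *\<^sub>v t)) \<bullet> (M i (rev a) *\<^sub>v t)))"
  define k where "k = (\<Sum>j\<in>UNIV. \<Sum>m\<in>{m. length m < d}. (H j *\<^sub>v e m) \<bullet> (H j *\<^sub>v e m))"
  have Q: "(\<Sum>(a, i, b, j, c)\<in>splits2 d. 2 * Poly_Mapping.lookup p (a @ i # b @ j # c)
        * ((W b *\<^sub>v (H j *\<^sub>v e c)) \<bullet> (H i *\<^sub>v e (rev a)))) = 2 * Q"
    unfolding Q_def sum_distrib_left
    by (intro sum.cong) (auto simp: splits2_def He C_def)
  have *: "2 * Q + \<delta> * k \<ge> 0" if \<delta>: "\<delta> > 0" for \<delta>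
  proof -
    obtain l where "\<forall>H. (\<forall>j. H j \<in> sym_mats n) \<longrightarrow>
        (nc_eval n (case_sum X H) (relaxed_hessian p l \<delta>) *\<^sub>v v) \<bullet> v \<ge> 0"
      using pos[unfolded relaxed_hessian_positive_at_def, THEN spec, THEN mp, OF \<delta>] by blast
    then have "(nc_eval n (case_sum X H) (relaxed_hessian p l \<delta>) *\<^sub>v v) \<bullet> v \<ge> 0"
      using H by blast
    then show ?thesis
      unfolding eval_relaxed_hessian[OF H] y_def[symmetric] d_def[symmetric] yy Q k_def[symmetric]
      by simp
  qed
  have "Q \<ge> 0"
  proof (rule ccontr)
    assume "\<not> Q \<ge> 0"
    \<comment> \<open>This choice of \<open>\<delta>\<close> is positive and gives
      \<open>2 * Q + \<delta> * k \<le> Q\<close>, contradicting positivity of the relaxed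
      Hessian.\<close>
    moreover have "- Q / (\<bar>k\<bar> + 1) * k \<le> - Q"
    proof -
      have "- Q * k \<le> - Q * (\<bar>k\<bar> + 1)" using \<open>\<not> Q \<ge> 0\<close> by (intro mult_left_mono) auto
      then show ?thesis by (simp add: field_simps)
    qed
    moreover have "- Q / (\<bar>k\<bar> + 1) > 0" using \<open>\<not> Q \<ge> 0\<close> by (intro divide_pos_pos) auto
    ultimately show False using *[of "- Q / (\<bar>k\<bar> + 1)"] by linarith
  qed
  with t show ?thesis unfolding Q_def by blast
qed

end

section \<open>Test families, the degree bound and the quadratic part\<close>

lemma scalar_prod_smult_mat_vec:
  fixes A :: "real mat"
  assumes "A \<in> carrier_mat n n" "x \<in> carrier_vec n" "y \<in> carrier_vec n"
  shows "((k \<cdot>\<^sub>m A) *\<^sub>v x) \<bullet> y = k * ((A *\<^sub>v x) \<bullet> y)"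
  using assms by (simp add: scalar_prod_mult_mat_vec[of _ n n] sum_distrib_left mult.assoc)

lemma scalar_prod_add_mat_vec:
  fixes A B :: "real mat"
  assumes "A \<in> carrier_mat n n" "B \<in> carrier_mat n n" "x \<in> carrier_vec n" "y \<in> carrier_vec n"
  shows "((A + B) *\<^sub>v x) \<bullet> y = (A *\<^sub>v x) \<bullet> y + (B *\<^sub>v x) \<bullet> y"
  using assms by (simp add: scalar_prod_mult_mat_vec[of _ n n] distrib_right sum.distrib)

text \<open>Positive degree excludes the 0 inserted into the maximum, which is therefore attained by
  a word of \<open>p\<close>.\<close>

lemma exists_top_degree_word:
  assumes "nc_degree p > 0"
  obtains w where "Poly_Mapping.lookup p w \<noteq> 0" "length w = nc_degree p"
proof -
  have "nc_degree p \<in> insert 0 (length ` Poly_Mapping.keys p)"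
    unfolding nc_degree_def by (rule Max_in) auto
  then show thesis using assms that by (auto simp: in_keys_iff)
qed

lemma card_words:
  "card {w :: 'g::finite list. length w < d} = (\<Sum>i<d. CARD('g) ^ i)"
proof (cases d)
  case (Suc m)
  then show ?thesis
    using card_lists_length_le[of "UNIV :: 'g set" m]
    by (simp add: less_Suc_eq_le lessThan_Suc_atMost)
qed simp

lemma lookup_rev_of_symmetric:
  assumes "nc_symmetric p"
  shows "Poly_Mapping.lookup p (rev w) = Poly_Mapping.lookup p w"
  using assms lookup_nc_adj[of p w] by (simp add: nc_symmetric_def)

context nc_point
begin

lemma zero_mult_vec [simp]: "x \<in> carrier_vec n \<Longrightarrow> 0\<^sub>m n n *\<^sub>v x = 0\<^sub>v n"
  by (intro eq_vecI) auto

lemma W_zero [simp]: "W w *\<^sub>v 0\<^sub>v n = 0\<^sub>v n"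
  by (intro eq_vecI) auto

text \<open>A coordinate \<open>(j1, c1)\<close> with \<open>j1 # c1\<close> a top degree word of \<open>p\<close> does not enter the Hessian, while
  the first derivative depends on it through the nonzero scalar \<open>p1\<close>. It can therefore be used to make
  the first derivative vanish.\<close>

lemma nonneg_of_hessian_positive:
  fixes p :: "'g ncpoly" and M :: "'g \<Rightarrow> 'g list \<Rightarrow> real mat"
  defines "d \<equiv> nc_degree p"
  assumes indep: "\<not> (\<exists>q :: 'g ncpoly. q \<noteq> 0 \<and> nc_degree q < d \<and> nc_eval n X q *\<^sub>v v = 0\<^sub>v n)"
    and pos: "relaxed_hessian_positive_at n p X v"
    and n: "CARD('g) * (\<nu> * (\<nu> - 1) div 2) < n" and \<nu>: "\<nu> = card {w :: 'g list. length w < d}"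
    and d: "d > 0"
    and M: "\<And>j c. M j c \<in> carrier_mat n n" and M0: "\<And>j c. length c = d - 1 \<Longrightarrow> M j c = 0\<^sub>m n n"
  shows "\<exists>t\<in>carrier_vec n. t \<noteq> 0\<^sub>v n \<and>
    (\<Sum>(a, i, b, j, c)\<in>splits2 d. Poly_Mapping.lookup p (a @ i # b @ j # c)
        * ((W b *\<^sub>v (M j c *\<^sub>v t)) \<bullet> (M i (rev a) *\<^sub>v t))) \<ge> 0"
proof -
  obtain w where w: "Poly_Mapping.lookup p w \<noteq> 0" "length w = d"
    using d unfolding d_def by (rule exists_top_degree_word)
  obtain j1 c1 where w1: "w = j1 # c1" and c1: "length c1 = d - 1"
    using w(2) d by (cases w) auto
  define p1 where "p1 = Poly_Mapping.lookup p (j1 # c1)"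
  have p1: "p1 \<noteq> 0" using w(1) by (simp add: w1 p1_def)
  define cf where "cf = (\<lambda>(a, j, c). Poly_Mapping.lookup p (a @ j # c))"
  define A where "A = (\<lambda>(a, j, c). W a * M j c)"
  have A: "A s \<in> carrier_mat n n" for s
    by (cases s) (auto simp: A_def intro: mult_carrier_mat[OF W_carrier M])
  \<comment> \<open>\<open>S\<close> is the first derivative along \<open>M\<close> as a linear map
    of \<open>t\<close>. The coordinate \<open>(j1, c1)\<close> enters the derivative with the
    scalar \<open>p1\<close>, so the value \<open>- S / p1\<close> there cancels it.\<close>
  define S where "S = mat n n (\<lambda>ij. \<Sum>s\<in>splits1 d. cf s * A s $$ ij)"
  define M' where "M' j c = (if j = j1 \<and> c = c1 then (- 1 / p1) \<cdot>\<^sub>m S else M j c)" for j c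
  have S: "S \<in> carrier_mat n n" by (simp add: S_def)
  have M': "M' j c \<in> carrier_mat n n" for j c using M S by (simp add: M'_def)
  have ker: "(\<Sum>(a, j, c)\<in>splits1 d. Poly_Mapping.lookup p (a @ j # c) * ((W a *\<^sub>v (M' j c *\<^sub>v t)) \<bullet> y)) = 0"
    if t: "t \<in> carrier_vec n" and y: "y \<in> carrier_vec n" for t y
  proof -
    have A': "(A (a, j, c) *\<^sub>v t) = W a *\<^sub>v (M j c *\<^sub>v t)" for a j c
      unfolding A_def using assoc_mult_mat_vec[OF W_carrier M t] by simp
    define r where "r = (((- 1 / p1) \<cdot>\<^sub>m S) *\<^sub>v t) \<bullet> y"
    have "(\<Sum>(a, j, c)\<in>splits1 d. Poly_Mapping.lookup p (a @ j # c) * ((W a *\<^sub>v (M' j c *\<^sub>v t)) \<bullet> y))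
        = (\<Sum>s\<in>splits1 d. cf s * ((A s *\<^sub>v t) \<bullet> y) + (if s = ([], j1, c1) then p1 * r else 0))"
    proof (intro sum.cong refl)
      fix s :: "'g list \<times> 'g \<times> 'g list" assume s: "s \<in> splits1 d"
      obtain a j c where sajc: "s = (a, j, c)" by (cases s)
      have St: "((- 1 / p1) \<cdot>\<^sub>m S) *\<^sub>v t \<in> carrier_vec n"
        using S t by (intro mult_mat_vec_carrier[of _ n n]) auto
      have "Poly_Mapping.lookup p (a @ j # c) * ((W a *\<^sub>v (M' j c *\<^sub>v t)) \<bullet> y)
          = cf s * ((A s *\<^sub>v t) \<bullet> y) + (if s = ([], j1, c1) then p1 * r else 0)"
      proof (cases "j = j1 \<and> c = c1")
        case True
        \<comment> \<open>Since \<open>c1\<close> has length \<open>d - 1\<close>, the length bound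
          leaves no room for a prefix. By \<open>M0\<close> the old family vanishes there.\<close>
        then have "a = []" using s c1 d by (cases a) (auto simp: sajc splits1_def)
        then show ?thesis
          using True St t y M0[OF c1] by (simp add: sajc A' M'_def cf_def p1_def r_def)
      next
        case False
        then show ?thesis by (auto simp: sajc A' M'_def cf_def)
      qed
      then show "(case s of (a, j, c) \<Rightarrow> Poly_Mapping.lookup p (a @ j # c) * ((W a *\<^sub>v (M' j c *\<^sub>v t)) \<bullet> y))
          = cf s * ((A s *\<^sub>v t) \<bullet> y) + (if s = ([], j1, c1) then p1 * r else 0)"
        by (simp add: sajc)
    qed
    also have "\<dots> = (S *\<^sub>v t) \<bullet> y + p1 * r"
    proof -
      have "([], j1, c1) \<in> splits1 d" using c1 d by (simp add: splits1_def)
      then show ?thesis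
        unfolding S_def scalar_prod_mat_sum[where A = A, OF A t y]
        by (simp add: sum.distrib finite_splits1)
    qed
    also have "\<dots> = 0"
      using p1 unfolding r_def scalar_prod_smult_mat_vec[OF S t y] by simp
    finally show ?thesis .
  qed
  obtain t where t: "t \<in> carrier_vec n" "t \<noteq> 0\<^sub>v n"
    and nn: "(\<Sum>(a, i, b, j, c)\<in>splits2 d. Poly_Mapping.lookup p (a @ i # b @ j # c)
        * ((W b *\<^sub>v (M' j c *\<^sub>v t)) \<bullet> (M' i (rev a) *\<^sub>v t))) \<ge> 0"
    using nonneg_on_kernel_of_derivative[where M = M', OF indep[unfolded d_def] pos n \<nu>[unfolded d_def] M',
        folded d_def, OF ker] by blast
  have "(\<Sum>(a, i, b, j, c)\<in>splits2 d. Poly_Mapping.lookup p (a @ i # b @ j # c)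
        * ((W b *\<^sub>v (M' j c *\<^sub>v t)) \<bullet> (M' i (rev a) *\<^sub>v t)))
      = (\<Sum>(a, i, b, j, c)\<in>splits2 d. Poly_Mapping.lookup p (a @ i # b @ j # c)
        * ((W b *\<^sub>v (M j c *\<^sub>v t)) \<bullet> (M i (rev a) *\<^sub>v t)))"
    \<comment> \<open>In \<open>splits2 d\<close> both \<open>a\<close> and \<open>c\<close> are
      shorter than \<open>d - 1\<close>, so the modified coordinate never occurs.\<close>
    using c1 by (intro sum.cong refl) (auto simp: splits2_def M'_def)
  with t nn show ?thesis by auto
qed

text \<open>For \<open>d \<ge> 3\<close> a top degree word \<open>i0 # j0 # c0\<close> couples the
  distinct coordinates \<open>(i0, [])\<close> and \<open>(j0, c0)\<close>. The latter has no
  diagonal entry, because a word with \<open>c0\<close> on both sides of two letters is too long;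
  the form is thus indefinite.\<close>

lemma degree_le_2:
  fixes p :: "'g ncpoly"
  defines "d \<equiv> nc_degree p"
  assumes sym: "nc_symmetric p"
    and indep: "\<not> (\<exists>q :: 'g ncpoly. q \<noteq> 0 \<and> nc_degree q < d \<and> nc_eval n X q *\<^sub>v v = 0\<^sub>v n)"
    and pos: "relaxed_hessian_positive_at n p X v"
    and n: "CARD('g) * (\<nu> * (\<nu> - 1) div 2) < n" and \<nu>: "\<nu> = card {w :: 'g list. length w < d}"
  shows "d \<le> 2"
proof (rule ccontr)
  assume "\<not> d \<le> 2"
  then have d: "d \<ge> 3" by simp
  have "nc_degree p > 0" using d by (simp add: d_def)
  then obtain w where w: "Poly_Mapping.lookup p w \<noteq> 0" "length w = d"
    unfolding d_def by (rule exists_top_degree_word)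
  obtain i0 j0 c0 where w0: "w = i0 # j0 # c0" and c0: "length c0 = d - 2"
    using w(2) d by (cases w; cases "tl w") auto
  define p0 where "p0 = Poly_Mapping.lookup p (i0 # j0 # c0)"
  have p0: "p0 \<noteq> 0" using w(1) by (simp add: w0 p0_def)
  have p0': "Poly_Mapping.lookup p (rev c0 @ [j0, i0]) = p0"
    using lookup_rev_of_symmetric[OF sym, of "i0 # j0 # c0"] by (simp add: p0_def)
  \<comment> \<open>The words that fit between two letters \<open>i0\<close> when both outer parts
    are empty.\<close>
  define B where "B = {b :: 'g list. length b < d - 1}"
  define A where "A = mat n n (\<lambda>ij. \<Sum>b\<in>B. Poly_Mapping.lookup p (i0 # b @ [i0]) * W b $$ ij)"
  \<comment> \<open>Half the Hessian, restricted to the coordinates \<open>(i0, [])\<close>, \<open>(j0, c0)\<close> is \<open>[[A, p0 I], [p0 I, 0]]\<close>;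
    on the graph of \<open>N\<close> it takes the value \<open>- (t \<bullet> t)\<close>.\<close>
  define N where "N = (- 1 / (2 * p0)) \<cdot>\<^sub>m (A + 1\<^sub>m n)"
  have A: "A \<in> carrier_mat n n" by (simp add: A_def)
  have N: "N \<in> carrier_mat n n" using A by (simp add: N_def)
  define M where "M j c = (if j = i0 \<and> c = [] then 1\<^sub>m n else if j = j0 \<and> c = c0 then N else 0\<^sub>m n n)"
    for j c
  have M: "M j c \<in> carrier_mat n n" for j c using N by (simp add: M_def)
  have M0: "M j c = 0\<^sub>m n n" if "length c = d - 1" for j c
    using that c0 d by (auto simp: M_def)
  have c0': "c0 \<noteq> []" using c0 d by auto
  obtain t where t: "t \<in> carrier_vec n" "t \<noteq> 0\<^sub>v n"
    and nn: "(\<Sum>(a, i, b, j, c)\<in>splits2 d. Poly_Mapping.lookup p (a @ i # b @ j # c)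
        * ((W b *\<^sub>v (M j c *\<^sub>v t)) \<bullet> (M i (rev a) *\<^sub>v t))) \<ge> 0"
    using nonneg_of_hessian_positive[where M = M, OF indep[unfolded d_def] pos n \<nu>[unfolded d_def] _ M,
        folded d_def, OF _ M0] d by auto
  define T where "T = (\<lambda>(a, i, b, j, c). Poly_Mapping.lookup p (a @ i # b @ j # c)
        * ((W b *\<^sub>v (M j c *\<^sub>v t)) \<bullet> (M i (rev a) *\<^sub>v t)))"
  define R where "R = (\<lambda>b. ([] :: 'g list, i0, b, i0, [] :: 'g list)) ` B"
  have fB: "finite B" unfolding B_def by (rule finite_words)
  have Nt: "N *\<^sub>v t \<in> carrier_vec n" by (rule mult_mat_vec_carrier[OF N t(1)])
  \<comment> \<open>A nonzero term needs both outer coordinates in the support of \<open>M\<close>.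
    For mixed coordinates the length of \<open>c0\<close> forces an empty middle word, and
    \<open>(j0, c0)\<close> cannot occur twice.\<close>
  have "(\<Sum>s\<in>splits2 d. T s) = (\<Sum>s\<in>R \<union> {([], i0, [], j0, c0), (rev c0, j0, [], i0, [])}. T s)"
  proof (rule sum.mono_neutral_right)
    show "R \<union> {([], i0, [], j0, c0), (rev c0, j0, [], i0, [])} \<subseteq> splits2 d"
      using c0 d by (auto simp: R_def B_def splits2_def)
    show "\<forall>s\<in>splits2 d - (R \<union> {([], i0, [], j0, c0), (rev c0, j0, [], i0, [])}). T s = 0"
    proof
      fix s assume s: "s \<in> splits2 d - (R \<union> {([], i0, [], j0, c0), (rev c0, j0, [], i0, [])})"
      obtain a i b j c where sd: "s = (a, i, b, j, c)" by (cases s)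
      have len: "length a + length b + length c + 1 < d" using s by (simp add: sd splits2_def)
      have "M j c = 0\<^sub>m n n \<or> M i (rev a) = 0\<^sub>m n n"
      proof (rule ccontr)
        assume "\<not> (M j c = 0\<^sub>m n n \<or> M i (rev a) = 0\<^sub>m n n)"
        then have jc: "(j = i0 \<and> c = []) \<or> (j = j0 \<and> c = c0)"
          and ia: "(i = i0 \<and> a = []) \<or> (i = j0 \<and> a = rev c0)"
          by (auto simp: M_def split: if_splits)
        show False
          using jc ia
        proof (elim disjE conjE)
          assume "j = i0" "c = []" "i = i0" "a = []"
          then show False using s len by (auto simp: sd R_def B_def)
        next
          assume "j = i0" "c = []" "i = j0" "a = rev c0"
          moreover from this have "b = []" using len c0 d by (cases b) auto
          ultimately show False using s by (simp add: sd)
        next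
          assume "j = j0" "c = c0" "i = i0" "a = []"
          moreover from this have "b = []" using len c0 d by (cases b) auto
          ultimately show False using s by (simp add: sd)
        next
          assume "j = j0" "c = c0" "i = j0" "a = rev c0"
          then show False using len c0 d by simp
        qed
      qed
      moreover have "W b *\<^sub>v (M j c *\<^sub>v t) \<in> carrier_vec n" "M i (rev a) *\<^sub>v t \<in> carrier_vec n"
        using mult_mat_vec_carrier[OF M t(1)] by simp_all
      ultimately show "T s = 0" using t(1) by (auto simp: T_def sd)
    qed
  qed (rule finite_splits2)
  also have "\<dots> = (\<Sum>s\<in>R. T s) + (T ([], i0, [], j0, c0) + T (rev c0, j0, [], i0, []))"
    using fB c0' by (subst sum.union_disjoint) (auto simp: R_def)
  also have "(\<Sum>s\<in>R. T s) = (\<Sum>b\<in>B. Poly_Mapping.lookup p (i0 # b @ [i0]) * ((W b *\<^sub>v t) \<bullet> t))"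
    unfolding R_def using t(1) by (subst sum.reindex) (auto simp: inj_on_def T_def M_def)
  also have "\<dots> = (A *\<^sub>v t) \<bullet> t"
    unfolding A_def by (rule scalar_prod_mat_sum[OF W_carrier t(1) t(1), symmetric])
  also have "T ([], i0, [], j0, c0) + T (rev c0, j0, [], i0, []) = 2 * p0 * ((N *\<^sub>v t) \<bullet> t)"
    using t(1) Nt c0' comm_scalar_prod[OF t(1) Nt] by (simp add: T_def M_def p0' p0_def[symmetric])
  also have "(N *\<^sub>v t) \<bullet> t = (- 1 / (2 * p0)) * ((A *\<^sub>v t) \<bullet> t + t \<bullet> t)"
    unfolding N_def using scalar_prod_smult_mat_vec[of "A + 1\<^sub>m n" n t t]
      scalar_prod_add_mat_vec[OF A one_carrier_mat t(1) t(1)] A t(1)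
    by simp
  finally have "(\<Sum>s\<in>splits2 d. T s) = - (t \<bullet> t)" using p0 by (simp add: field_simps)
  then have "t \<bullet> t \<le> 0" using nn by (simp add: T_def)
  then have "t \<bullet> t = 0" using scalar_prod_self_nonneg[of t] by simp
  then show False using t scalar_prod_self_eq_0_iff by blast
qed

lemma quadratic_part_nonneg:
  fixes p :: "'g ncpoly" and \<alpha> :: "'g \<Rightarrow> real"
  defines "d \<equiv> nc_degree p"
  assumes indep: "\<not> (\<exists>q :: 'g ncpoly. q \<noteq> 0 \<and> nc_degree q < d \<and> nc_eval n X q *\<^sub>v v = 0\<^sub>v n)"
    and pos: "relaxed_hessian_positive_at n p X v"
    and n: "CARD('g) * (\<nu> * (\<nu> - 1) div 2) < n" and \<nu>: "\<nu> = card {w :: 'g list. length w < d}"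
    and d: "d = 2"
  shows "(\<Sum>i\<in>UNIV. \<Sum>j\<in>UNIV. Poly_Mapping.lookup p [i, j] * (\<alpha> i * \<alpha> j)) \<ge> 0"
proof -
  \<comment> \<open>Scalar matrices make the Hessian the quadratic form in \<open>\<alpha>\<close>
    times \<open>t \<bullet> t\<close>. The family is zero on words of length
    \<open>d - 1 = 1\<close>, as required.\<close>
  define M where "M j c = (if c = [] then \<alpha> j \<cdot>\<^sub>m 1\<^sub>m n else 0\<^sub>m n n)" for j and c :: "'g list"
  have M: "M j c \<in> carrier_mat n n" for j c by (simp add: M_def)
  have M0: "M j c = 0\<^sub>m n n" if "length c = d - 1" for j c
    using that d by (auto simp: M_def)
  obtain t where t: "t \<in> carrier_vec n" "t \<noteq> 0\<^sub>v n"
    and nn: "(\<Sum>(a, i, b, j, c)\<in>splits2 d. Poly_Mapping.lookup p (a @ i # b @ j # c)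
        * ((W b *\<^sub>v (M j c *\<^sub>v t)) \<bullet> (M i (rev a) *\<^sub>v t))) \<ge> 0"
    using nonneg_of_hessian_positive[where M = M, OF indep[unfolded d_def] pos n \<nu>[unfolded d_def] _ M,
        folded d_def, OF _ M0] d by auto
  have Mt: "M j [] *\<^sub>v t = \<alpha> j \<cdot>\<^sub>v t" for j
    using t(1) by (intro eq_vecI) (auto simp: M_def)
  \<comment> \<open>For \<open>d = 2\<close> the two marked letters use up the whole word.\<close>
  have "splits2 d = (\<lambda>(i, j). ([], i, [], j, [])) ` (UNIV :: ('g \<times> 'g) set)"
    by (auto simp: splits2_def d image_iff)
  then have "(\<Sum>(a, i, b, j, c)\<in>splits2 d. Poly_Mapping.lookup p (a @ i # b @ j # c)
        * ((W b *\<^sub>v (M j c *\<^sub>v t)) \<bullet> (M i (rev a) *\<^sub>v t)))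
      = (\<Sum>(i, j)\<in>UNIV. Poly_Mapping.lookup p [i, j] * (\<alpha> i * \<alpha> j) * (t \<bullet> t))"
    using t(1) by (simp only:) (subst sum.reindex, auto simp: inj_on_def Mt intro!: sum.cong)
  also have "\<dots> = (\<Sum>i\<in>UNIV. \<Sum>j\<in>UNIV. Poly_Mapping.lookup p [i, j] * (\<alpha> i * \<alpha> j)) * (t \<bullet> t)"
    by (simp add: sum_distrib_right sum.cartesian_product split_def)
  finally have "(\<Sum>i\<in>UNIV. \<Sum>j\<in>UNIV. Poly_Mapping.lookup p [i, j] * (\<alpha> i * \<alpha> j)) * (t \<bullet> t) \<ge> 0"
    using nn by simp
  moreover have "t \<bullet> t > 0"
    using t scalar_prod_self_nonneg[of t] scalar_prod_self_eq_0_iff[OF t(1)] by (simp add: less_le)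
  ultimately show ?thesis by (simp add: zero_le_mult_iff)
qed

end

section \<open>Convexity in degree two\<close>

lemma nc_eval_transpose:
  assumes X: "\<And>j. X j \<in> sym_mats n"
  shows "(nc_eval n X p)\<^sup>T = nc_eval n X (nc_adj p)"
proof (rule eq_matI)
  fix i j assume "i < dim_row (nc_eval n X (nc_adj p))" "j < dim_col (nc_eval n X (nc_adj p))"
  then have ij: "i < n" "j < n" by (simp_all add: nc_eval_def)
  have c: "X j \<in> carrier_mat n n" for j using sym_matsD(1)[OF X] .
  have "word_eval n X w $$ (j, i) = word_eval n X (rev w) $$ (i, j)" for w
    using word_eval_transpose[where X = X and w = w, OF X] word_eval_carrier[where X = X and w = w, OF c] ij
    by (metis carrier_matD index_transpose_mat(1))
  then have "wsum (\<lambda>w. word_eval n X w $$ (j, i)) p = wsum (\<lambda>w. word_eval n X w $$ (i, j)) (nc_adj p)"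
    unfolding wsum_adj by (intro wsum_cong)
  then show "(nc_eval n X p)\<^sup>T $$ (i, j) = nc_eval n X (nc_adj p) $$ (i, j)"
    using ij by (simp add: nc_eval_def wsum_def)
qed (simp_all add: nc_eval_def)

text \<open>Constant and linear words have no convexity defect. That of the quadratic part is
  \<open>t * (1 - t)\<close> times its value at \<open>X - Y\<close>, which splits over the
  coordinates \<open>k\<close> of the vectors \<open>(X j - Y j) u\<close>.\<close>

lemma nc_convex_of_quadratic_part_nonneg:
  fixes p :: "'g::finite ncpoly"
  assumes sym: "nc_symmetric p" and deg: "nc_degree p \<le> 2"
    and psd: "\<And>\<alpha>. (\<Sum>i\<in>UNIV. \<Sum>j\<in>UNIV. Poly_Mapping.lookup p [i, j] * (\<alpha> i * \<alpha> j)) \<ge> 0"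
  shows "nc_convex p"
  unfolding nc_convex_def
proof (intro allI impI)
  fix n :: nat and X Y :: "'g \<Rightarrow> real mat" and t :: real
  assume X: "\<forall>j. X j \<in> sym_mats n" and Y: "\<forall>j. Y j \<in> sym_mats n" and t: "0 \<le> t" "t \<le> 1"
  define Z where "Z j = t \<cdot>\<^sub>m X j + (1 - t) \<cdot>\<^sub>m Y j" for j
  have Xs: "X j \<in> sym_mats n" and Ys: "Y j \<in> sym_mats n" for j using X Y by auto
  have Xc: "X j \<in> carrier_mat n n" and Yc: "Y j \<in> carrier_mat n n" for j
    using sym_matsD(1) Xs Ys by blast+
  have smT: "(k \<cdot>\<^sub>m A)\<^sup>T = k \<cdot>\<^sub>m A\<^sup>T" for k :: real and A by (intro eq_matI) auto
  have Zc: "Z j \<in> carrier_mat n n" for j using Xc Yc by (simp add: Z_def)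
  have Zs: "Z j \<in> sym_mats n" for j
    using transpose_add[of "t \<cdot>\<^sub>m X j" n n "(1 - t) \<cdot>\<^sub>m Y j"] Xc Yc Zc sym_matsD(2)[OF Xs] sym_matsD(2)[OF Ys]
    by (simp add: sym_mats_def Z_def smT)
  define D where "D = t \<cdot>\<^sub>m nc_eval n X p + (1 - t) \<cdot>\<^sub>m nc_eval n Y p - nc_eval n Z p"
  have D: "D \<in> carrier_mat n n" unfolding D_def by (intro minus_carrier_mat) simp
  have evT: "(nc_eval n V p)\<^sup>T = nc_eval n V p" if "\<And>j. V j \<in> sym_mats n" for V
    using nc_eval_transpose[where X = V, OF that] sym by (simp add: nc_symmetric_def)
  have "D\<^sup>T = D"
    unfolding D_def
    by (simp add: transpose_minus[of _ n n] transpose_add[of _ n n] smT evT Xs Ys Zs)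
  then have Ds: "D \<in> sym_mats n" using D by (simp add: sym_mats_def)
  have "(D *\<^sub>v u) \<bullet> u \<ge> 0" if u: "u \<in> carrier_vec n" for u
  proof -
    define q where "q V w = (word_eval n V w *\<^sub>v u) \<bullet> u" for V :: "'g \<Rightarrow> real mat" and w
    \<comment> \<open>The contribution of a single word to the convexity defect, tested at
      \<open>u\<close>.\<close>
    define f where "f w = t * q X w + (1 - t) * q Y w - q Z w" for w
    define x where "x V j k = (V j *\<^sub>v u) $ k" for V :: "'g \<Rightarrow> real mat" and j k
    have q1: "q V [j] = (V j *\<^sub>v u) \<bullet> u" if "\<And>j. V j \<in> sym_mats n" for V j
      using right_mult_one_mat[OF sym_matsD(1)[OF that[of j]]] by (simp add: q_def)
    have q2: "q V [i, j] = (\<Sum>k<n. x V i k * x V j k)" if V: "\<And>j. V j \<in> sym_mats n" for V i j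
    proof -
      note Vc = sym_matsD(1)[OF V]
      have Vu: "V j *\<^sub>v u \<in> carrier_vec n" for j by (rule mult_mat_vec_carrier[OF Vc u])
      have "q V [i, j] = (V i *\<^sub>v (V j *\<^sub>v u)) \<bullet> u"
        using assoc_mult_mat_vec[OF Vc Vc u] right_mult_one_mat[OF Vc[of j]] by (simp add: q_def)
      also have "\<dots> = (V j *\<^sub>v u) \<bullet> (V i *\<^sub>v u)"
        using scalar_prod_mult_transpose[OF Vc Vu u] sym_matsD(2)[OF V] by simp
      also have "\<dots> = (\<Sum>k<n. x V i k * x V j k)"
        using Vc[of i] by (simp add: scalar_prod_def x_def atLeast0LessThan mult.commute)
      finally show ?thesis .
    qed
    have xZ: "x Z j k = t * x X j k + (1 - t) * x Y j k" if "k < n" for j k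
      using that Xc[of j] Yc[of j] u
      by (simp add: x_def Z_def scalar_prod_def sum.distrib sum_subtractf sum_distrib_left algebra_simps)
    have f0: "f [] = 0" by (simp add: f_def q_def algebra_simps)
    have f1: "f [j] = 0" for j
      using Xc[of j] Yc[of j] u
      by (simp add: f_def q1[where V = X, OF Xs] q1[where V = Y, OF Ys] q1[where V = Z, OF Zs] Z_def
          scalar_prod_add_mat_vec[of _ n] scalar_prod_smult_mat_vec[of _ n])
    have f2: "f [i, j] = t * (1 - t) * (\<Sum>k<n. (x X i k - x Y i k) * (x X j k - x Y j k))" for i j
    proof -
      have "f [i, j] = (\<Sum>k<n. t * (x X i k * x X j k) + (1 - t) * (x Y i k * x Y j k) - x Z i k * x Z j k)"
        by (simp add: f_def q2 Xs Ys Zs sum_distrib_left sum.distrib sum_subtractf)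
      also have "\<dots> = (\<Sum>k<n. t * (1 - t) * ((x X i k - x Y i k) * (x X j k - x Y j k)))"
        by (intro sum.cong refl) (simp add: xZ algebra_simps)
      finally show ?thesis by (simp add: sum_distrib_left)
    qed
    have "(D *\<^sub>v u) \<bullet> u = t * wsum (q X) p + (1 - t) * wsum (q Y) p - wsum (q Z) p"
    proof -
      have "D = t \<cdot>\<^sub>m nc_eval n X p + (1 - t) \<cdot>\<^sub>m nc_eval n Y p + (- 1) \<cdot>\<^sub>m nc_eval n Z p"
        unfolding D_def by (intro eq_matI) (auto simp: nc_eval_def)
      then have "(D *\<^sub>v u) \<bullet> u = t * ((nc_eval n X p *\<^sub>v u) \<bullet> u) + (1 - t) * ((nc_eval n Y p *\<^sub>v u) \<bullet> u)
          - (nc_eval n Z p *\<^sub>v u) \<bullet> u"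
        using u by (simp add: scalar_prod_add_mat_vec[of _ n] scalar_prod_smult_mat_vec[of _ n])
      then show ?thesis
        unfolding q_def
        by (simp add: scalar_prod_nc_eval[where X = X, OF Xc u u] scalar_prod_nc_eval[where X = Y, OF Yc u u]
            scalar_prod_nc_eval[where X = Z, OF Zc u u])
    qed
    also have "\<dots> = wsum f p"
      unfolding f_def wsum_def
      by (simp add: sum_distrib_left sum.distrib sum_subtractf algebra_simps)
    also have "\<dots> = (\<Sum>w\<in>{w. length w \<le> 2}. Poly_Mapping.lookup p w * f w)"
    proof (rule wsum_superset)
      show "finite {w :: 'g list. length w \<le> 2}"
        using finite_words[where ?'g = 'g, of 3] by (simp add: less_Suc_eq_le numeral_3_eq_3 numeral_2_eq_2)
      show "Poly_Mapping.keys p \<subseteq> {w. length w \<le> 2}"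
        using lookup_le_degree[of p] deg by (auto simp: in_keys_iff intro: order_trans)
    qed
    also have "\<dots> = (\<Sum>w\<in>(\<lambda>(i, j). [i, j]) ` UNIV. Poly_Mapping.lookup p w * f w)"
    proof (rule sum.mono_neutral_right)
      show "finite {w :: 'g list. length w \<le> 2}"
        using finite_words[where ?'g = 'g, of 3] by (simp add: less_Suc_eq_le numeral_3_eq_3 numeral_2_eq_2)
      show "\<forall>w\<in>{w. length w \<le> 2} - (\<lambda>(i, j). [i, j]) ` UNIV. Poly_Mapping.lookup p w * f w = 0"
      proof
        fix w :: "'g list" assume w: "w \<in> {w. length w \<le> 2} - (\<lambda>(i, j). [i, j]) ` UNIV"
        then have "w = [] \<or> (\<exists>j. w = [j])"
          by (cases w; cases "tl w") (auto simp: image_iff)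
        then show "Poly_Mapping.lookup p w * f w = 0" using f0 f1 by auto
      qed
    qed auto
    also have "\<dots> = (\<Sum>i\<in>UNIV. \<Sum>j\<in>UNIV. Poly_Mapping.lookup p [i, j] * f [i, j])"
      by (subst sum.reindex) (auto simp: inj_on_def sum.cartesian_product intro!: sum.cong)
    also have "\<dots> = t * (1 - t) * (\<Sum>i\<in>UNIV. \<Sum>j\<in>UNIV. \<Sum>k<n.
        Poly_Mapping.lookup p [i, j] * ((x X i k - x Y i k) * (x X j k - x Y j k)))"
      by (simp add: f2 sum_distrib_left mult_ac)
    also have "(\<Sum>i\<in>UNIV. \<Sum>j\<in>UNIV. \<Sum>k<n.
          Poly_Mapping.lookup p [i, j] * ((x X i k - x Y i k) * (x X j k - x Y j k)))
        = (\<Sum>i\<in>UNIV. \<Sum>k<n. \<Sum>j\<in>UNIV.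
          Poly_Mapping.lookup p [i, j] * ((x X i k - x Y i k) * (x X j k - x Y j k)))"
      by (intro sum.cong refl sum.swap)
    also have "\<dots> = (\<Sum>k<n. \<Sum>i\<in>UNIV. \<Sum>j\<in>UNIV.
          Poly_Mapping.lookup p [i, j] * ((x X i k - x Y i k) * (x X j k - x Y j k)))"
      by (rule sum.swap)
    \<comment> \<open>For each \<open>k\<close> apply \<open>psd\<close> with
      \<open>\<alpha> i = x X i k - x Y i k\<close>.\<close>
    also have "t * (1 - t) * \<dots> \<ge> 0"
      using t by (intro mult_nonneg_nonneg sum_nonneg psd) auto
    finally show ?thesis .
  qed
  with Ds have "psd_mat n D" by (simp add: psd_mat_def)
  then show "psd_mat n (t \<cdot>\<^sub>m nc_eval n X p + (1 - t) \<cdot>\<^sub>m nc_eval n Y p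
      - nc_eval n (\<lambda>j. t \<cdot>\<^sub>m X j + (1 - t) \<cdot>\<^sub>m Y j) p)"
    by (simp add: D_def Z_def[abs_def])
qed

theorem theorem1p4:
  fixes p :: "'g::finite ncpoly" and X :: "'g \<Rightarrow> real mat" and v :: "real Matrix.vec"
    and n d g :: nat and \<nu> :: real
  assumes "nc_symmetric p"
    and "nc_degree p = d"
    and "g = CARD('g)"
    and "\<nu> = (\<Sum>i<d. real g ^ i)"
    and "real n > 1 / 2 * real g * \<nu> * (\<nu> - 1)"
    and "\<And>j. X j \<in> sym_mats n"
    and "v \<in> carrier_vec n"
    and "\<not> (\<exists>q :: 'g ncpoly. q \<noteq> 0 \<and> nc_degree q < d \<and> nc_eval n X q *\<^sub>v v = 0\<^sub>v n)"
    and "relaxed_hessian_positive_at n p X v"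
  shows "nc_convex p \<and> nc_degree p \<le> 2"
proof -
  interpret nc_point n X v by standard (rule assms(6), rule assms(7))
  define N where "N = card {w :: 'g list. length w < nc_degree p}"
  have \<nu>: "\<nu> = real N" by (simp add: assms(2,3,4) N_def card_words)
  \<comment> \<open>The natural division is exact because \<open>N * (N - 1)\<close> is even; for
    \<open>N = 0\<close> both sides are 0 despite the truncated subtraction.\<close>
  have "real (N * (N - 1) div 2) = \<nu> * (\<nu> - 1) / 2"
    by (cases N) (simp_all add: \<nu> real_of_nat_div algebra_simps)
  then have "real (CARD('g) * (N * (N - 1) div 2)) < real n"
    using assms(5) by (simp only: assms(3) of_nat_mult[of "CARD('g)"])
  then have n: "CARD('g) * (N * (N - 1) div 2) < n" by (simp only: of_nat_less_iff)
  note indep = assms(8)[folded assms(2)]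
  have deg: "nc_degree p \<le> 2" by (rule degree_le_2[OF assms(1) indep assms(9) n N_def])
  have "(\<Sum>i\<in>UNIV. \<Sum>j\<in>UNIV. Poly_Mapping.lookup p [i, j] * (\<alpha> i * \<alpha> j)) \<ge> 0" for \<alpha>
  proof (cases "nc_degree p = 2")
    case True
    then show ?thesis by (rule quadratic_part_nonneg[OF indep assms(9) n N_def])
  next
    \<comment> \<open>Below degree two there are no quadratic coefficients, and the form is
      zero.\<close>
    case False
    then have "Poly_Mapping.lookup p [i, j] = 0" for i j
      using deg lookup_le_degree[of p "[i, j]"] by fastforce
    then show ?thesis by simp
  qed
  then have "nc_convex p" by (rule nc_convex_of_quadratic_part_nonneg[OF assms(1) deg])
  with deg show ?thesis by blast
qed

end
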